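(* Let $(F_n)_{n\ge0}$ be a $2$-tower such that $F_0$ is a number field. Then $(F_n)_{n\ge0}$ is not thin if and only if there exists $n\ge2$ such that the extension $F_n/F_{n-2}$ is Galois with Galois group isomorphic to the Klein four-group.
   Context: A $2$-tower is a (possibly finite) sequence $(F_n)_{n\ge0}$ of subfields of a fixed algebraic closure of $\mathbb{Q}$ with $[F_{n+1}:F_n]=2$ for each $n$ (so $F_n\subseteq F_{n+1}$). A $2$-tower $(F_n)_{n\ge0}$ is thin if the only finite extensions of $F_0$ contained in $\bigcup_nF_n$ are the fields $F_n$. *)

theory Defs
  imports
    "HOL-Algebra.Algebraic_Closure_Type"
    "HOL-Algebra.Elementary_Groups"
    "HOL-Algebra.Bij"
    "HOL-Library.Extended_Nat"
begin

context ring
begin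

definition finite_field_extension :: "'a set \<Rightarrow> 'a set \<Rightarrow> bool" where
  "finite_field_extension K E \<longleftrightarrow>
     subfield K R \<and> subfield E R \<and> K \<subseteq> E \<and> finite_dimension K E"

text \<open>The tower consists of the fields \<open>F n\<close> with \<open>n \<le> N\<close>; it is infinite iff \<open>N = \<infinity>\<close>.
  Values of \<open>F\<close> beyond \<open>N\<close> are irrelevant.\<close>

definition two_tower :: "enat \<Rightarrow> (nat \<Rightarrow> 'a set) \<Rightarrow> bool" where
  "two_tower N F \<longleftrightarrow>
     (\<forall>n. enat n \<le> N \<longrightarrow> subfield (F n) R) \<and>
     (\<forall>n. enat (Suc n) \<le> N \<longrightarrow> F n \<subseteq> F (Suc n) \<and> dimension 2 (F n) (F (Suc n)))"

definition thin :: "enat \<Rightarrow> (nat \<Rightarrow> 'a set) \<Rightarrow> bool" where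
  "thin N F \<longleftrightarrow>
     (\<forall>E. finite_field_extension (F 0) E \<and> E \<subseteq> (\<Union>n\<in>{n. enat n \<le> N}. F n) \<longrightarrow>
          (\<exists>n. enat n \<le> N \<and> E = F n))"

text \<open>The following notions are for subfields of an algebraically closed field \<open>R\<close>.
  \<open>splitted_on\<close> is unsuitable for normality: it intersects with \<open>mset_set E\<close>, which is empty
  for infinite \<open>E\<close>.\<close>

definition normal_extension :: "'a set \<Rightarrow> 'a set \<Rightarrow> bool" where
  "normal_extension K E \<longleftrightarrow>
     (\<forall>x\<in>E. (algebraic over K) x) \<and>
     (\<forall>p\<in>carrier (K[X]). pirreducible K p \<and> (\<exists>x\<in>E. eval p x = \<zero>) \<longrightarrow>
        splitted p \<and> set_mset (roots p) \<subseteq> E)"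

definition separable_extension :: "'a set \<Rightarrow> 'a set \<Rightarrow> bool" where
  "separable_extension K E \<longleftrightarrow>
     (\<forall>x\<in>E. (algebraic over K) x \<and> (\<forall>y\<in>carrier R. alg_mult (Irr K x) y \<le> 1))"

definition galois_extension :: "'a set \<Rightarrow> 'a set \<Rightarrow> bool" where
  "galois_extension K E \<longleftrightarrow>
     subfield K R \<and> subfield E R \<and> K \<subseteq> E \<and> normal_extension K E \<and> separable_extension K E"

text \<open>Automorphisms are extensional on \<open>E\<close>, so that they are determined by their values there.\<close>

definition galois_group :: "'a set \<Rightarrow> 'a set \<Rightarrow> ('a \<Rightarrow> 'a) monoid" where
  "galois_group K E =
     BijGroup E \<lparr>carrier := {\<sigma> \<in> Bij E.
       \<sigma> \<in> ring_iso (R\<lparr>carrier := E\<rparr>) (R\<lparr>carrier := E\<rparr>) \<and> (\<forall>x\<in>K. \<sigma> x = x)}\<rparr>"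

end

definition klein_four_group :: "(int \<times> int) monoid" where
  "klein_four_group = integer_mod_group 2 \<times>\<times> integer_mod_group 2"

end

theory Submission
  imports Defs
begin

text \<open>
  Suppose the tower has an extra subfield, and let \<open>n\<close> be minimal such that \<open>F n\<close> contains one.
  Adjoining the generators of the tower one at a time enlarges it to a subfield \<open>E\<close> of index 2 in
  \<open>F n\<close>; put \<open>M = F (n - 1)\<close>, so that \<open>E \<inter> M = F m\<close> by minimality, and choose \<open>E\<close> with \<open>m\<close> largest.
  The conjugation of \<open>F n\<close> over \<open>E\<close> negates the generator of \<open>F (m + 1)\<close> over \<open>F m\<close>, so the image of
  \<open>M\<close> meets \<open>M\<close> in more than \<open>F m\<close>; it must equal \<open>M\<close>, as it could replace \<open>E\<close> otherwise. Descent along this conjugation gives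
  \<open>m = n - 2\<close> and a generator of \<open>F n\<close> over \<open>M\<close> whose square lies in \<open>F m\<close>, that is, a biquadratic
  extension. Conversely, if the Galois group is the Klein four-group, some involution moves
  \<open>F (n - 1)\<close>, and its fixed field is not in the tower.
\<close>

section \<open>Quadratic extensions\<close>

text \<open>Characteristic other than 2 is what permits completing the square and splitting an
  element into a fixed and a negated part under an involution.\<close>

locale field_two_nonzero = field +
  assumes two_nonzero: "\<one> \<oplus> \<one> \<noteq> \<zero>"
begin

text \<open>This is \<open>E = K(a)\<close> with \<open>a\<close> a square root of an element of
  \<open>K\<close>, written through the basis 1, \<open>a\<close> so that later arguments can
  compute with coordinates.\<close>

definition quadratic :: "'a set \<Rightarrow> 'a set \<Rightarrow> 'a \<Rightarrow> bool" where
  "quadratic K E a \<longleftrightarrow> subfield K R \<and> subfield E R \<and> K \<subseteq> E \<and> a \<in> E \<and> a \<notin> K \<and> a \<otimes> a \<in> K \<and>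
     (\<forall>x\<in>E. \<exists>p\<in>K. \<exists>q\<in>K. x = p \<oplus> q \<otimes> a)"

section \<open>Subfields and division by two\<close>

lemma subfield_closed:
  assumes "subfield K R"
  shows "x \<in> K \<Longrightarrow> x \<in> carrier R" "\<zero> \<in> K" "\<one> \<in> K"
    "x \<in> K \<Longrightarrow> y \<in> K \<Longrightarrow> x \<oplus> y \<in> K" "x \<in> K \<Longrightarrow> y \<in> K \<Longrightarrow> x \<otimes> y \<in> K"
    "x \<in> K \<Longrightarrow> \<ominus> x \<in> K" "x \<in> K \<Longrightarrow> y \<in> K \<Longrightarrow> x \<ominus> y \<in> K"
    "x \<in> K \<Longrightarrow> x \<noteq> \<zero> \<Longrightarrow> inv x \<in> K"
  using subringE[OF subfieldE(1)[OF assms]] subfield_m_inv(1)[OF assms]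
  by (auto simp: a_minus_def)

lemma subfieldI_closed:
  assumes "H \<subseteq> carrier R" "\<one> \<in> H" "\<And>x y. x \<in> H \<Longrightarrow> y \<in> H \<Longrightarrow> x \<ominus> y \<in> H"
    "\<And>x y. x \<in> H \<Longrightarrow> y \<in> H \<Longrightarrow> x \<otimes> y \<in> H" "\<And>x. x \<in> H \<Longrightarrow> x \<noteq> \<zero> \<Longrightarrow> inv x \<in> H"
  shows "subfield H R"
proof -
  have z: "\<zero> \<in> H" using assms(1,2) assms(3)[of \<one> \<one>] by (simp add: a_minus_def r_neg)
  have m: "\<ominus> x \<in> H" if "x \<in> H" for x
    using assms(1) assms(3)[OF z that] that by (auto simp: a_minus_def)
  have "subring H R"
  proof (rule subringI)
    show "x \<oplus> y \<in> H" if "x \<in> H" "y \<in> H" for x y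
      using assms(1) assms(3)[OF that(1) m[OF that(2)]] that by (auto simp: a_minus_def)
  qed (use assms m in auto)
  then show ?thesis
    using assms(5) by (intro subfieldI') auto
qed

lemma two_cancel:
  assumes "x \<in> carrier R" "x \<oplus> x = \<zero>" shows "x = \<zero>"
proof -
  have "(\<one> \<oplus> \<one>) \<otimes> x = \<zero>" using assms by (simp add: l_distr)
  then show ?thesis using two_nonzero assms by (meson add.m_closed integral one_closed)
qed

lemma eq_neg_imp_zero:
  assumes "x \<in> carrier R" "x = \<ominus> x" shows "x = \<zero>"
  using assms two_cancel[of x] r_neg[of x] by simp

lemma square_eq_imp:
  assumes "x \<in> carrier R" "y \<in> carrier R" "x \<otimes> x = y \<otimes> y"
  shows "x = y \<or> x = \<ominus> y"
proof -
  have "(x \<ominus> y) \<otimes> (x \<oplus> y) = x \<otimes> x \<ominus> y \<otimes> y" using assms(1,2) by algebra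
  also have "\<dots> = \<zero>" using assms by (simp add: a_minus_def r_neg)
  finally have "x \<ominus> y = \<zero> \<or> x \<oplus> y = \<zero>"
    using assms by (meson add.m_closed integral minus_closed)
  then show ?thesis using assms minus_equality[of x y] by (auto simp: r_right_minus_eq)
qed

definition half :: 'a where "half = inv (\<one> \<oplus> \<one>)"

lemma half_in_subfield: "subfield K R \<Longrightarrow> half \<in> K"
  unfolding half_def using two_nonzero by (simp add: subfield_closed)

lemma half_closed [simp]: "half \<in> carrier R"
  using half_in_subfield[OF carrier_is_subfield] .

lemma half_double: "half \<oplus> half = \<one>"
proof -
  have "half \<oplus> half = half \<otimes> (\<one> \<oplus> \<one>)" by (simp add: r_distr)
  also have "\<dots> = \<one>" unfolding half_def using two_nonzero by (simp add: field_Units)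
  finally show ?thesis .
qed

lemma half_double_mult: "x \<in> carrier R \<Longrightarrow> half \<otimes> x \<oplus> half \<otimes> x = x"
  using half_double l_distr[of half half x] by simp

lemma inter_subfield:
  assumes "subfield K R" "subfield E R" shows "subfield (K \<inter> E) R"
  by (rule subfieldI_closed) (use subfield_closed[OF assms(1)] subfield_closed[OF assms(2)] in auto)

section \<open>Coordinates with respect to a quadratic generator\<close>

lemma quadraticD:
  assumes "quadratic K E a"
  shows "subfield K R" "subfield E R" "K \<subseteq> E" "a \<in> E" "a \<notin> K" "a \<otimes> a \<in> K"
    "a \<in> carrier R" "a \<noteq> \<zero>"
  using assms subfield_closed(1,2) unfolding quadratic_def by auto

lemma quadratic_decompose:
  assumes "quadratic K E a" "x \<in> E"
  obtains p q where "p \<in> K" "q \<in> K" "x = p \<oplus> q \<otimes> a"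
  using assms unfolding quadratic_def by blast

text \<open>If the coefficients of \<open>a\<close> differed, dividing by their difference would
  express \<open>a\<close> through elements of \<open>K\<close>.\<close>

lemma coordinates_unique:
  assumes K: "subfield K R" and a: "a \<in> carrier R" "a \<notin> K"
    and pq: "p \<in> K" "q \<in> K" "p' \<in> K" "q' \<in> K" and eq: "p \<oplus> q \<otimes> a = p' \<oplus> q' \<otimes> a"
  shows "p = p'" "q = q'"
proof -
  note c = subfield_closed[OF K]
  have cc: "p \<in> carrier R" "q \<in> carrier R" "p' \<in> carrier R" "q' \<in> carrier R" using c(1) pq by auto
  have e: "(q \<ominus> q') \<otimes> a = p' \<ominus> p"
  proof -
    have "(q \<ominus> q') \<otimes> a = (p \<oplus> q \<otimes> a) \<ominus> p \<ominus> q' \<otimes> a" using cc a by algebra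
    also have "\<dots> = (p' \<oplus> q' \<otimes> a) \<ominus> p \<ominus> q' \<otimes> a" using eq by simp
    also have "\<dots> = p' \<ominus> p" using cc a by algebra
    finally show ?thesis .
  qed
  have "q \<ominus> q' = \<zero>"
  proof (rule ccontr)
    assume n: "q \<ominus> q' \<noteq> \<zero>"
    have d: "q \<ominus> q' \<in> K" using c(7) pq by blast
    have "a = inv (q \<ominus> q') \<otimes> ((q \<ominus> q') \<otimes> a)"
      using n d a c(1) by (simp add: m_assoc[symmetric] field_Units)
    also have "\<dots> \<in> K" unfolding e by (simp add: c n d pq)
    finally show False using a by blast
  qed
  then show q: "q = q'" using cc by (simp add: r_right_minus_eq)
  show "p = p'" using eq q cc a by (metis add.right_cancel m_closed)
qed

text \<open>Any \<open>y\<close> in \<open>E\<close> outside \<open>K\<close> can replace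
  \<open>a\<close> in the basis, whether or not its square lies in \<open>K\<close>: in
  \<open>y = u + v a\<close> the coefficient \<open>v\<close> is nonzero, so \<open>a\<close> can be
  solved for.\<close>

lemma quadratic_change:
  assumes "quadratic K E a" "y \<in> E" "y \<notin> K" "x \<in> E"
  obtains p q where "p \<in> K" "q \<in> K" "x = p \<oplus> q \<otimes> y"
proof -
  note Q = quadraticD[OF assms(1)]
  note c = subfield_closed[OF Q(1)]
  obtain u v where uv: "u \<in> K" "v \<in> K" "y = u \<oplus> v \<otimes> a" by (rule quadratic_decompose[OF assms(1,2)])
  obtain s t where st: "s \<in> K" "t \<in> K" "x = s \<oplus> t \<otimes> a" by (rule quadratic_decompose[OF assms(1,4)])
  have cc: "u \<in> carrier R" "v \<in> carrier R" "s \<in> carrier R" "t \<in> carrier R" using c(1) uv st by auto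
  have v: "v \<noteq> \<zero>" using uv assms(3) Q(7) cc by auto
  have iv: "inv v \<in> K" "v \<otimes> inv v = \<one>" "inv v \<in> carrier R"
    using c v uv cc by (auto simp: field_Units)
  have "x = (s \<ominus> (t \<otimes> inv v) \<otimes> u) \<oplus> (t \<otimes> inv v) \<otimes> y"
  proof -
    have "(s \<ominus> (t \<otimes> inv v) \<otimes> u) \<oplus> (t \<otimes> inv v) \<otimes> y = s \<oplus> t \<otimes> (v \<otimes> inv v) \<otimes> a"
      unfolding uv(3) using cc Q(7) iv(3) by algebra
    then show ?thesis unfolding iv(2) st(3) using cc Q(7) by simp
  qed
  from that[OF _ _ this] show ?thesis by (simp add: c iv uv st)
qed

lemma quadraticI_adjoin:
  assumes "quadratic K E a" "y \<in> E" "y \<notin> K" "y \<otimes> y \<in> K"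
  shows "quadratic K E y"
  using assms quadratic_change[OF assms(1-3)] unfolding quadratic_def by metis

text \<open>A single element of \<open>M\<close> outside \<open>K\<close> already generates all of
  \<open>E\<close>.\<close>

lemma quadratic_no_intermediate:
  assumes "quadratic K E a" "subfield M R" "K \<subseteq> M" "M \<subseteq> E"
  shows "M = K \<or> M = E"
proof (rule ccontr)
  assume n: "\<not> ?thesis"
  then obtain y where y: "y \<in> M" "y \<notin> K" using assms by blast
  have "E \<subseteq> M"
  proof
    fix x assume "x \<in> E"
    then obtain p q where "p \<in> K" "q \<in> K" "x = p \<oplus> q \<otimes> y"
      using quadratic_change[OF assms(1) _ y(2)] y(1) assms(4) by blast
    then show "x \<in> M" using subfield_closed(4,5)[OF assms(2)] assms(3) y by blast
  qed
  then show False using n assms by blast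
qed

text \<open>Any \<open>x\<close> in \<open>E\<close> outside \<open>K\<close> gives a basis
  \<open>x\<close>, 1, so \<open>x\<close> satisfies a quadratic equation over \<open>K\<close>;
  completing the square turns it into a square root.\<close>

lemma dimension_two_quadratic:
  assumes K: "subfield K R" and E: "subfield E R" and "K \<subseteq> E" and dim: "dimension 2 K E"
  shows "\<exists>a. quadratic K E a"
proof -
  note c = subfield_closed[OF K] note d = subfield_closed[OF E]
  have "E \<noteq> K" using dimension_is_inj[OF K dim] dimension_one[OF K] by fastforce
  then obtain x where x: "x \<in> E" "x \<notin> K" using assms by blast
  have sp: "Span K [\<one>] = K"
    using c(1) line_extension_mem_iff[of _ K \<one> "{\<zero>}"] by auto
  have "independent K [x, \<one>]"
  proof (intro li_Cons)
    show "x \<notin> Span K [\<one>]" using sp x by simp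
  qed (use x d(1) in auto)
  then have sx: "Span K [x, \<one>] = E"
    using independent_length_eq_dimension[OF K dim, of "[x, \<one>]"] x d(3) by simp
  have dec: "\<exists>p\<in>K. \<exists>q\<in>K. y = p \<oplus> q \<otimes> x" if "y \<in> E" for y
  proof -
    have "y \<in> line_extension K x K" using that sx sp by simp
    then obtain q p where "q \<in> K" "p \<in> K" "y = q \<otimes> x \<oplus> p" unfolding line_extension_mem_iff by blast
    then show ?thesis using a_comm c(1) d(1) x by (metis m_closed)
  qed
  obtain p q where pq: "p \<in> K" "q \<in> K" "x \<otimes> x = p \<oplus> q \<otimes> x" using dec[OF d(5)[OF x(1) x(1)]] by blast
  define h where "h = half \<otimes> q"
  have hK: "h \<in> K" unfolding h_def by (simp add: half_in_subfield[OF K] pq c)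
  have hq: "h \<oplus> h = q" unfolding h_def by (simp add: half_double_mult c(1) pq)
  have cc: "p \<in> carrier R" "h \<in> carrier R" "x \<in> carrier R" using c(1) d(1) pq x hK by auto
  \<comment> \<open>With \<open>h = q/2\<close>, the relation \<open>x^2 = p + q x\<close> becomes
    \<open>(x - h)^2 = p + h^2\<close>.\<close>
  define a where "a = x \<ominus> h"
  have xa: "x = h \<oplus> a" unfolding a_def using cc by algebra
  have aE: "a \<in> E" unfolding a_def using hK \<open>K \<subseteq> E\<close> by (simp add: d x subsetD)
  have aK: "a \<notin> K" using c(4)[OF hK, of a] xa x(2) by metis
  have ac: "a \<in> carrier R" using aE d(1) by blast
  have "a \<otimes> a = x \<otimes> x \<ominus> (h \<oplus> h) \<otimes> x \<oplus> h \<otimes> h" unfolding a_def using cc by algebra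
  also have "\<dots> = (p \<oplus> (h \<oplus> h) \<otimes> x) \<ominus> (h \<oplus> h) \<otimes> x \<oplus> h \<otimes> h" using pq hq by simp
  also have "\<dots> = p \<oplus> h \<otimes> h" using cc by algebra
  finally have aa: "a \<otimes> a \<in> K" using c pq hK by simp
  have "\<exists>p\<in>K. \<exists>q\<in>K. y = p \<oplus> q \<otimes> a" if "y \<in> E" for y
  proof -
    obtain r s where rs: "r \<in> K" "s \<in> K" "y = r \<oplus> s \<otimes> x" using dec \<open>y \<in> E\<close> by blast
    have rc: "r \<in> carrier R" "s \<in> carrier R" using rs c(1) by auto
    have "y = (r \<oplus> s \<otimes> h) \<oplus> s \<otimes> a" unfolding rs(3) a_def using rc cc by algebra
    then show ?thesis using rs c(4)[OF rs(1) c(5)[OF rs(2) hK]] by blast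
  qed
  then show ?thesis unfolding quadratic_def using assms aE aK aa by blast
qed

lemma quadratic_dimension:
  assumes "quadratic K E a" shows "dimension 2 K E"
proof -
  note Q = quadraticD[OF assms] note c = subfield_closed[OF Q(1)] note d = subfield_closed[OF Q(2)]
  have sp: "Span K [\<one>] = K"
    using c(1) line_extension_mem_iff[of _ K \<one> "{\<zero>}"] by auto
  have "independent K [a, \<one>]"
  proof (intro li_Cons)
    show "a \<notin> Span K [\<one>]" using sp Q by simp
  qed (use Q in auto)
  moreover have "Span K [a, \<one>] = E"
  proof -
    have "x \<in> E \<longleftrightarrow> x \<in> line_extension K a K" for x
    proof
      assume "x \<in> E"
      then obtain p q where "p \<in> K" "q \<in> K" "x = p \<oplus> q \<otimes> a" by (rule quadratic_decompose[OF assms])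
      then show "x \<in> line_extension K a K"
        unfolding line_extension_mem_iff using a_comm c(1) Q(7) by (metis m_closed)
    next
      assume "x \<in> line_extension K a K"
      then obtain q p where "q \<in> K" "p \<in> K" "x = q \<otimes> a \<oplus> p" unfolding line_extension_mem_iff by blast
      then show "x \<in> E" using Q(3,4) by (auto intro!: d(4,5))
    qed
    then show ?thesis using sp by auto
  qed
  ultimately show ?thesis using dimensionI[OF Q(1), of "[a, \<one>]" E] by (simp add: numeral_2_eq_2)
qed

section \<open>Automorphisms\<close>

text \<open>Preservation of \<open>\<one>\<close> is contained in the last clause, since
  \<open>\<one>\<close> lies in \<open>K\<close>.\<close>

lemma galois_group_carrier_iff:
  assumes "subfield K R" "K \<subseteq> E"
  shows "s \<in> carrier (galois_group K E) \<longleftrightarrow> s \<in> extensional E \<and> bij_betw s E E \<and>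
    (\<forall>x\<in>E. \<forall>y\<in>E. s (x \<oplus> y) = s x \<oplus> s y) \<and> (\<forall>x\<in>E. \<forall>y\<in>E. s (x \<otimes> y) = s x \<otimes> s y) \<and> (\<forall>x\<in>K. s x = x)"
  unfolding galois_group_def Bij_def ring_iso_def ring_hom_def
  using subfield_closed(3)[OF assms(1)] assms(2) by (auto simp: bij_betw_def)

lemma galois_group_mult:
  assumes "s \<in> carrier (galois_group K E)" "t \<in> carrier (galois_group K E)"
  shows "s \<otimes>\<^bsub>galois_group K E\<^esub> t = compose E s t"
  using assms unfolding galois_group_def BijGroup_def by simp

lemma galois_group_mult_closed:
  assumes "subfield K R" "subfield E R" "K \<subseteq> E"
    and "s \<in> carrier (galois_group K E)" "t \<in> carrier (galois_group K E)"
  shows "compose E s t \<in> carrier (galois_group K E)"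
proof -
  note s = assms(4)[unfolded galois_group_carrier_iff[OF assms(1,3)]]
  note t = assms(5)[unfolded galois_group_carrier_iff[OF assms(1,3)]]
  note d = subfield_closed[OF assms(2)]
  have tE: "t x \<in> E" if "x \<in> E" for x using t that bij_betwE by blast
  have "bij_betw (compose E s t) E E" using s t bij_betw_compose by blast
  then show ?thesis
    unfolding galois_group_carrier_iff[OF assms(1,3)]
    using s t assms(3) by (auto simp: compose_def tE d)
qed

lemma galois_group_id:
  assumes "subfield K R" "subfield E R" "K \<subseteq> E"
  shows "(\<lambda>x\<in>E. x) \<in> carrier (galois_group K E)"
  unfolding galois_group_carrier_iff[OF assms(1,3)] using assms subfield_closed[OF assms(2)]
  by (auto simp: bij_betw_def inj_on_def)

lemma galois_group_elem:
  assumes "subfield K R" "subfield E R" "K \<subseteq> E" "s \<in> carrier (galois_group K E)"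
  shows "x \<in> E \<Longrightarrow> s x \<in> E" "bij_betw s E E" "x \<in> K \<Longrightarrow> s x = x"
    "x \<in> E \<Longrightarrow> y \<in> E \<Longrightarrow> s (x \<oplus> y) = s x \<oplus> s y"
    "x \<in> E \<Longrightarrow> y \<in> E \<Longrightarrow> s (x \<otimes> y) = s x \<otimes> s y"
    "s \<zero> = \<zero>" "s \<one> = \<one>"
    "x \<in> E \<Longrightarrow> s (\<ominus> x) = \<ominus> s x"
    "x \<in> E \<Longrightarrow> y \<in> E \<Longrightarrow> s (x \<ominus> y) = s x \<ominus> s y"
    "x \<in> E \<Longrightarrow> x \<noteq> \<zero> \<Longrightarrow> s (inv x) = inv (s x)"
    "x \<in> E \<Longrightarrow> s x = \<zero> \<Longrightarrow> x = \<zero>"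
proof -
  note s = assms(4)[unfolded galois_group_carrier_iff[OF assms(1,3)]]
  note c = subfield_closed[OF assms(1)] note d = subfield_closed[OF assms(2)]
  show E: "s x \<in> E" if "x \<in> E" for x using s that bij_betwE by blast
  show "bij_betw s E E" using s by blast
  show fixK: "s x = x" if "x \<in> K" for x using s that by blast
  show add: "s (x \<oplus> y) = s x \<oplus> s y" if "x \<in> E" "y \<in> E" for x y using s that by blast
  show mult: "s (x \<otimes> y) = s x \<otimes> s y" if "x \<in> E" "y \<in> E" for x y using s that by blast
  show zero: "s \<zero> = \<zero>" and one: "s \<one> = \<one>" using fixK c by auto
  show neg: "s (\<ominus> x) = \<ominus> s x" if "x \<in> E" for x
  proof -
    have "s (\<ominus> x) \<oplus> s x = \<zero>" using add[of "\<ominus> x" x] that d zero by (simp add: l_neg)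
    then show ?thesis using minus_equality E d that by metis
  qed
  show "s (x \<ominus> y) = s x \<ominus> s y" if "x \<in> E" "y \<in> E" for x y
    using that by (simp add: a_minus_def add neg d)
  show inj: "x = \<zero>" if "x \<in> E" "s x = \<zero>" for x
    using s zero that d(2) unfolding bij_betw_def by (metis inj_onD)
  show "s (inv x) = inv (s x)" if "x \<in> E" "x \<noteq> \<zero>" for x
  proof -
    have "s (inv x) \<otimes> s x = \<one>"
      using mult[of "inv x" x] that d one by (simp add: field_Units)
    then show ?thesis using E d that by (metis comm_inv_char m_comm inv_char)
  qed
qed

text \<open>The map is \<open>p + q a \<mapsto> p - q a\<close>. It is well defined by uniqueness of
  coordinates and multiplicative because the square of \<open>a\<close> lies in
  \<open>K\<close>.\<close>

lemma quadratic_conjugation: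
  assumes "quadratic K E a"
  obtains s where "s \<in> carrier (galois_group K E)" "s a = \<ominus> a"
    "\<And>x. x \<in> E \<Longrightarrow> s (s x) = x" "\<And>x. x \<in> E \<Longrightarrow> s x = x \<longleftrightarrow> x \<in> K"
proof -
  note Q = quadraticD[OF assms] note c = subfield_closed[OF Q(1)] note d = subfield_closed[OF Q(2)]
  define s where "s = (\<lambda>x\<in>E. THE y. \<exists>p\<in>K. \<exists>q\<in>K. x = p \<oplus> q \<otimes> a \<and> y = p \<ominus> q \<otimes> a)"
  have s: "s (p \<oplus> q \<otimes> a) = p \<ominus> q \<otimes> a" if "p \<in> K" "q \<in> K" for p q
  proof -
    have "p \<oplus> q \<otimes> a \<in> E" using that Q(3,4) d(4,5) by blast
    moreover have "(THE y. \<exists>p'\<in>K. \<exists>q'\<in>K. p \<oplus> q \<otimes> a = p' \<oplus> q' \<otimes> a \<and> y = p' \<ominus> q' \<otimes> a) = p \<ominus> q \<otimes> a"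
      by (rule the_equality) (use that coordinates_unique[OF Q(1,7,5)] in metis)+
    ultimately show ?thesis by (simp add: s_def)
  qed
  have E: "s x \<in> E" if x: "x \<in> E" for x
  proof -
    obtain p q where "p \<in> K" "q \<in> K" "x = p \<oplus> q \<otimes> a" by (rule quadratic_decompose[OF assms x])
    then show ?thesis using s Q(3,4) d(5,7) by (metis subsetD)
  qed
  have ss: "s (s x) = x" if x: "x \<in> E" for x
  proof -
    obtain p q where pq: "p \<in> K" "q \<in> K" "x = p \<oplus> q \<otimes> a" by (rule quadratic_decompose[OF assms x])
    have cc: "p \<in> carrier R" "q \<in> carrier R" using pq c(1) by auto
    have "s x = p \<oplus> (\<ominus> q) \<otimes> a" unfolding pq(3) s[OF pq(1,2)] using cc Q(7) by algebra
    then have "s (s x) = p \<ominus> (\<ominus> q) \<otimes> a" using s[OF pq(1) c(6)[OF pq(2)]] by simp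
    then show ?thesis unfolding pq(3) using cc Q(7) by algebra
  qed
  \<comment> \<open>An involution is its own inverse.\<close>
  have "bij_betw s E E" by (rule bij_betw_byWitness[where f' = s]) (use ss E in auto)
  moreover have "s (x \<oplus> y) = s x \<oplus> s y \<and> s (x \<otimes> y) = s x \<otimes> s y" if xy: "x \<in> E" "y \<in> E" for x y
  proof -
    obtain p q where pq: "p \<in> K" "q \<in> K" "x = p \<oplus> q \<otimes> a" by (rule quadratic_decompose[OF assms xy(1)])
    obtain u v where uv: "u \<in> K" "v \<in> K" "y = u \<oplus> v \<otimes> a" by (rule quadratic_decompose[OF assms xy(2)])
    have cc: "p \<in> carrier R" "q \<in> carrier R" "u \<in> carrier R" "v \<in> carrier R" using pq uv c(1) by auto
    have "x \<oplus> y = (p \<oplus> u) \<oplus> (q \<oplus> v) \<otimes> a" unfolding pq(3) uv(3) using cc Q(7) by algebra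
    then have "s (x \<oplus> y) = (p \<oplus> u) \<ominus> (q \<oplus> v) \<otimes> a" using s pq uv c(4) by simp
    also have "\<dots> = s x \<oplus> s y" unfolding pq(3) uv(3) s[OF pq(1,2)] s[OF uv(1,2)] using cc Q(7) by algebra
    finally have 1: "s (x \<oplus> y) = s x \<oplus> s y" .
    have "x \<otimes> y = (p \<otimes> u \<oplus> q \<otimes> v \<otimes> (a \<otimes> a)) \<oplus> (p \<otimes> v \<oplus> q \<otimes> u) \<otimes> a"
      unfolding pq(3) uv(3) using cc Q(7) by algebra
    then have "s (x \<otimes> y) = (p \<otimes> u \<oplus> q \<otimes> v \<otimes> (a \<otimes> a)) \<ominus> (p \<otimes> v \<oplus> q \<otimes> u) \<otimes> a"
      using s pq(1,2) uv(1,2) c(4,5) Q(6) by simp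
    also have "\<dots> = s x \<otimes> s y" unfolding pq(3) uv(3) s[OF pq(1,2)] s[OF uv(1,2)] using cc Q(7) by algebra
    finally show ?thesis using 1 by blast
  qed
  moreover have fixK: "s x = x" if "x \<in> K" for x
    using s[OF that c(2)] c(1)[OF that] Q(7) by (simp add: a_minus_def)
  ultimately have 1: "s \<in> carrier (galois_group K E)"
    unfolding galois_group_carrier_iff[OF Q(1,3)] by (auto simp: s_def)
  have 2: "s a = \<ominus> a" using s[OF c(2,3)] Q(7) by (simp add: a_minus_def)
  have "x \<in> K" if x: "x \<in> E" "s x = x" for x
  proof -
    obtain p q where pq: "p \<in> K" "q \<in> K" "x = p \<oplus> q \<otimes> a" by (rule quadratic_decompose[OF assms x(1)])
    have cc: "p \<in> carrier R" "q \<in> carrier R" using pq c(1) by auto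
    \<comment> \<open>The difference \<open>x - s x\<close> equals \<open>2 q a\<close>, so a fixed
      element has no \<open>a\<close>-component.\<close>
    have "x \<ominus> s x = \<zero>" using x d(1) by (simp add: a_minus_def r_neg)
    moreover have "x \<ominus> s x = q \<otimes> a \<oplus> q \<otimes> a" unfolding pq(3) s[OF pq(1,2)] using cc Q(7) by algebra
    ultimately have "q \<otimes> a = \<zero>" using two_cancel[of "q \<otimes> a"] cc Q(7) by simp
    then show ?thesis using pq cc by simp
  qed
  then show ?thesis using that[OF 1 2 ss] fixK by blast
qed

text \<open>Being a root of \<open>X^2 - a^2\<close>, the element \<open>a\<close> is algebraic, so
  the simple extension is a field; its elements are built by Horner steps \<open>k1 a + k2\<close>,
  in which \<open>a^2\<close> is absorbed into \<open>K\<close>.\<close>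

lemma simple_extension_quadratic:
  assumes K: "subfield K R" and a: "a \<in> carrier R" "a \<notin> K" "a \<otimes> a \<in> K"
  shows "quadratic K (simple_extension K a) a"
proof -
  note c = subfield_closed[OF K]
  \<comment> \<open>The list holds the coefficients of \<open>X^2 - a^2\<close>, leading one
    first.\<close>
  have "[\<one>, \<zero>, \<ominus> (a \<otimes> a)] \<in> carrier (K[X])"
    using a c unfolding univ_poly_def polynomial_def by auto
  moreover have "eval [\<one>, \<zero>, \<ominus> (a \<otimes> a)] a = \<zero>" using a by (simp add: r_neg numeral_2_eq_2)
  ultimately have "(algebraic over K) a" using algebraicI[of "[\<one>, \<zero>, \<ominus> (a \<otimes> a)]" K a] by blast
  then have sf: "subfield (simple_extension K a) R" using simple_extension_is_subfield[OF K a(1)] by blast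
  have KE: "K \<subseteq> simple_extension K a" using simple_extension_incl[OF _ a(1)] c(1) by blast
  have aE: "a \<in> simple_extension K a" using simple_extension_mem[OF subfieldE(1)[OF K] a(1)] .
  have "\<exists>p\<in>K. \<exists>q\<in>K. x = p \<oplus> q \<otimes> a" if "x \<in> simple_extension K a" for x
    using that
  proof induction
    case zero
    show ?case by (rule bexI[of _ \<zero>], rule bexI[of _ \<zero>]) (use a c in auto)
  next
    case (lin k1 k2)
    then obtain p q where pq: "p \<in> K" "q \<in> K" "k1 = p \<oplus> q \<otimes> a" by blast
    have cc: "p \<in> carrier R" "q \<in> carrier R" "k2 \<in> carrier R" using pq lin c(1) by auto
    have "k1 \<otimes> a \<oplus> k2 = (q \<otimes> (a \<otimes> a) \<oplus> k2) \<oplus> p \<otimes> a" unfolding pq(3) using cc a(1) by algebra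
    moreover have "q \<otimes> (a \<otimes> a) \<oplus> k2 \<in> K" using pq lin a c(4,5) by blast
    ultimately show ?case using pq by blast
  qed
  then show ?thesis unfolding quadratic_def using K sf KE aE a by blast
qed

text \<open>An automorphism of \<open>E\<close> carries a subfield of index 2 to one of index 2. The
  image may differ from \<open>M\<close>, since only \<open>K\<close> is known to be fixed.\<close>

lemma galois_image_quadratic:
  assumes "subfield K R" "subfield E R" "K \<subseteq> E" and s: "s \<in> carrier (galois_group K E)"
    and q: "quadratic M E b"
  shows "quadratic (s ` M) E (s b)"
proof -
  note g = galois_group_elem[OF assms(1-4)]
  note Q = quadraticD[OF q] note c = subfield_closed[OF Q(1)] note d = subfield_closed[OF Q(2)]
  have ME: "x \<in> E" if "x \<in> M" for x using that Q(3) by blast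
  have inj: "x = y" if "x \<in> E" "y \<in> E" "s x = s y" for x y
    using g(2) that unfolding bij_betw_def inj_on_def by blast
  have "subfield (s ` M) R"
  proof (rule subfieldI_closed)
    show "s ` M \<subseteq> carrier R" using g(1) d(1) ME by blast
    show "\<one> \<in> s ` M" using g(7) c(3) by (metis imageI)
    fix x assume "x \<in> s ` M"
    then obtain u where u: "u \<in> M" "x = s u" by blast
    { assume n: "x \<noteq> \<zero>"
      have "u \<noteq> \<zero>" using n u g(6) by auto
      then have "inv x = s (inv u)" "inv u \<in> M" using g(10) u ME c(8) by auto
      then show "inv x \<in> s ` M" by blast }
    fix y assume "y \<in> s ` M"
    then obtain v where v: "v \<in> M" "y = s v" by blast
    have "x \<ominus> y = s (u \<ominus> v)" "x \<otimes> y = s (u \<otimes> v)" using u v g(5,9) ME by auto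
    then show "x \<ominus> y \<in> s ` M" "x \<otimes> y \<in> s ` M" using u v c(5,7) by blast+
  qed
  moreover have "s ` M \<subseteq> E" using g(1) ME by blast
  moreover have "s b \<notin> s ` M" using inj ME Q(4,5) by blast
  moreover have "s b \<otimes> s b \<in> s ` M" using g(5)[OF Q(4) Q(4)] Q(6) by (metis imageI)
  moreover have "\<exists>p\<in>s ` M. \<exists>q\<in>s ` M. x = p \<oplus> q \<otimes> s b" if x: "x \<in> E" for x
  proof -
    obtain y where y: "y \<in> E" "x = s y" using g(2) x unfolding bij_betw_def by blast
    obtain u v where uv: "u \<in> M" "v \<in> M" "y = u \<oplus> v \<otimes> b" by (rule quadratic_decompose[OF q y(1)])
    have "x = s u \<oplus> s v \<otimes> s b" unfolding y(2) uv(3) using g(4,5) ME uv(1,2) d(5) Q(4) by simp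
    then show ?thesis using uv by blast
  qed
  ultimately show ?thesis unfolding quadratic_def using Q g(1) by blast
qed

section \<open>Subfields of towers\<close>

lemma two_tower_subfield:
  assumes "two_tower N F" "enat n \<le> N" shows "subfield (F n) R"
  using assms unfolding two_tower_def by blast

lemma enat_le_mono: "i \<le> j \<Longrightarrow> enat j \<le> N \<Longrightarrow> enat i \<le> N"
  by (meson enat_ord_simps(1) order_trans)

lemma two_tower_quadratic:
  assumes "two_tower N F" "enat (Suc n) \<le> N" shows "\<exists>a. quadratic (F n) (F (Suc n)) a"
proof -
  have "enat n \<le> N" using assms(2) enat_le_mono[of n "Suc n"] by simp
  then show ?thesis using assms dimension_two_quadratic unfolding two_tower_def by blast
qed

lemma two_tower_mono:
  assumes "two_tower N F" "i \<le> j" "enat j \<le> N" shows "F i \<subseteq> F j"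
  using assms(2,3)
proof (induction j rule: dec_induct)
  case (step j)
  have "enat j \<le> N" using step.prems enat_le_mono[of j "Suc j"] by simp
  then show ?case using step assms(1) unfolding two_tower_def by blast
qed simp

lemma two_tower_not_subset:
  assumes "two_tower N F" "i < j" "enat j \<le> N" shows "\<not> F j \<subseteq> F i"
proof -
  have i: "enat (Suc i) \<le> N" using assms enat_le_mono[of "Suc i" j] by simp
  obtain a where "quadratic (F i) (F (Suc i)) a" using two_tower_quadratic[OF assms(1) i] by blast
  then show ?thesis using quadraticD(4,5) two_tower_mono[OF assms(1), of "Suc i" j] assms by fastforce
qed

lemma two_tower_finite_dimension:
  assumes "two_tower N F" "enat n \<le> N" shows "finite_dimension (F 0) (F n)"
  using assms(2)
proof (induction n)
  case 0
  then show ?case using dimension_one[OF two_tower_subfield[OF assms(1)]] finite_dimensionI by blast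
next
  case (Suc n)
  have n: "enat n \<le> N" using Suc.prems enat_le_mono[of n "Suc n"] by simp
  have z: "enat 0 \<le> N" using n enat_le_mono[of 0 n] by simp
  obtain m where "dimension m (F 0) (F n)" using Suc.IH[OF n] by blast
  moreover have "dimension 2 (F n) (F (Suc n))" using assms(1) Suc.prems unfolding two_tower_def by blast
  ultimately show ?case
    using telescopic_base two_tower_subfield[OF assms(1)] n z finite_dimensionI by blast
qed

text \<open>Tower generators are adjoined to \<open>E\<close> for as long as the result stays proper
  in \<open>F n\<close>. The next generator has its square in the field reached so far, so that
  field has index 2.\<close>

lemma two_tower_maximal_subfield:
  assumes T: "two_tower N F" and n: "enat n \<le> N" and E: "subfield E R" "F 0 \<subseteq> E" "E \<subset> F n"
  shows "\<exists>D a. E \<subseteq> D \<and> quadratic D (F n) a"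
proof -
  \<comment> \<open>\<open>P i\<close> says that \<open>E\<close> and \<open>F i\<close> fit into a
    common proper subfield of \<open>F n\<close>; the greatest such \<open>i\<close> is
    taken.\<close>
  define P where "P = (\<lambda>i. i \<le> n \<and> (\<exists>D. subfield D R \<and> E \<union> F i \<subseteq> D \<and> D \<subset> F n))"
  have "P 0" unfolding P_def using E by blast
  moreover have "\<forall>i. P i \<longrightarrow> i \<le> n" unfolding P_def by blast
  ultimately obtain i where i: "P i" "\<And>j. P j \<Longrightarrow> j \<le> i"
    using GreatestI_nat[of P 0 n] Greatest_le_nat[of P _ n] by blast
  then obtain D where D: "subfield D R" "E \<union> F i \<subseteq> D" "D \<subset> F n" and "i \<le> n" unfolding P_def by blast
  have "i \<noteq> n" using D by blast
  then have i': "Suc i \<le> n" using \<open>i \<le> n\<close> by simp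
  have iN: "enat (Suc i) \<le> N" using i' n enat_le_mono by blast
  obtain a where a: "quadratic (F i) (F (Suc i)) a" using two_tower_quadratic[OF T iN] by blast
  note A = quadraticD[OF a]
  have notP: "\<not> P (Suc i)" using i(2)[of "Suc i"] by auto
  have sub: "F (Suc i) \<subseteq> D'" if "subfield D' R" "D \<subseteq> D'" "a \<in> D'" for D'
  proof
    fix x assume "x \<in> F (Suc i)"
    then obtain p q where "p \<in> F i" "q \<in> F i" "x = p \<oplus> q \<otimes> a" by (rule quadratic_decompose[OF a])
    then show "x \<in> D'" using subfield_closed(4,5)[OF that(1)] that(2,3) D(2) by blast
  qed
  \<comment> \<open>If \<open>a\<close> were in \<open>D\<close>, then \<open>D\<close> would
    contain \<open>F (Suc i)\<close>, against the choice of \<open>i\<close>.\<close>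
  have aD: "a \<notin> D" using sub[OF D(1)] notP D i' unfolding P_def by blast
  have q: "quadratic D (simple_extension D a) a"
    by (rule simple_extension_quadratic) (use A aD D in auto)
  note Q = quadraticD[OF q]
  have "a \<in> F n" using A(4) two_tower_mono[OF T i' n] by blast
  then have "simple_extension D a \<subseteq> F n"
    using simple_extension_subring_incl[OF subfieldE(1)[OF two_tower_subfield[OF T n]]] D(3) by blast
  moreover have "F (Suc i) \<subseteq> simple_extension D a" using sub Q by blast
  \<comment> \<open>This field contains \<open>E\<close> and \<open>F (Suc i)\<close>, so by the
    choice of \<open>i\<close> it cannot be proper in \<open>F n\<close>.\<close>
  ultimately have "simple_extension D a = F n" using notP D(2) Q(2,3) i' unfolding P_def by blast
  then show ?thesis using q D(2) by auto
qed

text \<open>Here \<open>n\<close> is the first level with a subfield outside the tower: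
  \<open>min\<close> says that below \<open>n\<close> every subfield over \<open>F 0\<close> is a
  tower field. An index-2 subfield \<open>E\<close> other than \<open>F k\<close>, with largest
  possible intersection with \<open>F k\<close>, forces the top two steps to be biquadratic.\<close>

lemma minimal_extra_subfield_biquadratic:
  assumes T: "two_tower N F" and n: "enat n \<le> N"
    and min: "\<And>m E. m < n \<Longrightarrow> subfield E R \<Longrightarrow> F 0 \<subseteq> E \<Longrightarrow> E \<subseteq> F m \<Longrightarrow> \<exists>j\<le>m. E = F j"
    and E0: "subfield E0 R" "F 0 \<subseteq> E0" "E0 \<subseteq> F n" "\<And>j. j \<le> n \<Longrightarrow> E0 \<noteq> F j"
  shows "\<exists>m a c. n = Suc (Suc m) \<and> quadratic (F m) (F (Suc m)) a \<and> quadratic (F (Suc m)) (F n) c \<and> c \<otimes> c \<in> F m"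
proof -
  have "n \<noteq> 0" using E0(2,3) E0(4)[of n] by auto
  then obtain k where k: "n = Suc k" using not0_implies_Suc by blast
  have kN: "enat k \<le> N" using n k enat_le_mono[of k "Suc k"] by simp
  have Fk: "subfield (F k) R" and Fn: "subfield (F n) R" using two_tower_subfield[OF T] kN n by auto
  note dk = subfield_closed[OF Fk] note dn = subfield_closed[OF Fn]
  obtain b where b: "quadratic (F k) (F n) b" using two_tower_quadratic[OF T] n k by blast
  note B = quadraticD[OF b]
  have F0k: "F 0 \<subseteq> F k" using two_tower_mono[OF T _ kN] by simp
  \<comment> \<open>The indices \<open>m\<close> for which \<open>F m\<close> is the intersection of
    \<open>F k\<close> with some other subfield of index 2 in \<open>F n\<close>.\<close>
  define P where "P = (\<lambda>m. m \<le> k \<and> (\<exists>E e. quadratic E (F n) e \<and> F 0 \<subseteq> E \<and> E \<noteq> F k \<and> E \<inter> F k = F m))"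
  have exP: "\<exists>j. P j \<and> E \<inter> F k = F j" if "quadratic E (F n) e" "F 0 \<subseteq> E" "E \<noteq> F k" for E e
  proof -
    have "\<exists>j\<le>k. E \<inter> F k = F j"
      using min[of k "E \<inter> F k"] inter_subfield[OF quadraticD(1)[OF that(1)] Fk] that F0k k by auto
    then show ?thesis unfolding P_def using that by blast
  qed
  have "E0 \<subset> F n" using E0 by blast
  then obtain D e where D: "E0 \<subseteq> D" "quadratic D (F n) e"
    using two_tower_maximal_subfield[OF T n E0(1,2)] by blast
  \<comment> \<open>Otherwise \<open>E0\<close> would lie in \<open>F k\<close>, and
    \<open>min\<close> would make it a tower field.\<close>
  have "D \<noteq> F k"
    using min[of k E0] E0 D k by (metis le_SucI lessI)
  then have "\<exists>j. P j" using exP[OF D(2)] D(1) E0(2) by blast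
  moreover have "\<forall>i. P i \<longrightarrow> i \<le> k" unfolding P_def by blast
  ultimately obtain m where m: "P m" "\<And>j. P j \<Longrightarrow> j \<le> m"
    using GreatestI_ex_nat[of P k] Greatest_le_nat[of P _ k] by blast
  then obtain E e where e: "quadratic E (F n) e" and E: "F 0 \<subseteq> E" "E \<noteq> F k" "E \<inter> F k = F m" and mk: "m \<le> k"
    unfolding P_def by blast
  note Q = quadraticD[OF e] note dE = subfield_closed[OF Q(1)]
  \<comment> \<open>Equality would place \<open>F k\<close> inside \<open>E\<close>; both are proper
    in \<open>F n\<close> and \<open>F k\<close> has index 2, so they would coincide.\<close>
  have "m \<noteq> k"
  proof
    assume "m = k"
    then have "F k \<subseteq> E" using E by blast
    then have "E = F k \<or> E = F n" using quadratic_no_intermediate[OF b Q(1)] Q(3) by blast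
    then show False using E Q(4,5) by blast
  qed
  then have mk': "Suc m \<le> k" using mk by simp
  have mN: "enat (Suc m) \<le> N" using mk' kN enat_le_mono by blast
  obtain a where a: "quadratic (F m) (F (Suc m)) a" using two_tower_quadratic[OF T mN] by blast
  note A = quadraticD[OF a] note dm = subfield_closed[OF A(1)]
  have ak: "a \<in> F k" using A(4) two_tower_mono[OF T mk' kN] by blast
  have aE: "a \<notin> E" using E(3) A(5) ak by blast
  have an: "a \<in> F n" using ak B(3) by blast
  \<comment> \<open>The generator \<open>a\<close> of the tower step above \<open>F m\<close> also
    generates \<open>F n\<close> over \<open>E\<close>, so the conjugation over \<open>E\<close>
    negates it.\<close>
  have qa: "quadratic E (F n) a" using quadraticI_adjoin[OF e an aE] A(6) E(3) by blast
  obtain s where s: "s \<in> carrier (galois_group E (F n))" "s a = \<ominus> a" "\<And>x. x \<in> F n \<Longrightarrow> s (s x) = x"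
    "\<And>x. x \<in> F n \<Longrightarrow> s x = x \<longleftrightarrow> x \<in> E" by (rule quadratic_conjugation[OF qa]) blast
  note g = galois_group_elem[OF Q(1,2,3) s(1)]
  \<comment> \<open>If the image of \<open>F k\<close> were different, it could play the role of
    \<open>E\<close>. Both it and \<open>F k\<close> contain \<open>a = s (- a)\<close>, so their
    intersection \<open>F j\<close> would contain \<open>a\<close>, whereas maximality of
    \<open>m\<close> puts \<open>F j\<close> inside \<open>F m\<close>.\<close>
  have sk: "s ` F k = F k"
  proof (rule ccontr)
    assume ne: "s ` F k \<noteq> F k"
    have "F 0 \<subseteq> s ` F k"
    proof
      fix x assume "x \<in> F 0"
      then show "x \<in> s ` F k" using g(3)[of x] E(1) F0k by (metis imageI subsetD)
    qed
    then obtain j where j: "P j" "s ` F k \<inter> F k = F j"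
      using exP[OF galois_image_quadratic[OF Q(1,2,3) s(1) b]] ne by blast
    have "a = s (\<ominus> a)" using g(8)[OF an] s(2) A(7) by simp
    then have "a \<in> s ` F k" using dk(6)[OF ak] by blast
    then have "a \<in> F j" using j(2) ak by blast
    moreover have "F j \<subseteq> F m" using two_tower_mono[OF T m(2)[OF j(1)]] mk kN enat_le_mono by blast
    ultimately show False using A(5) by blast
  qed
  \<comment> \<open>Write \<open>x = p + q a\<close> over \<open>E\<close>. As \<open>F k\<close> is
    stable under \<open>s\<close>, both \<open>p = (x + s x)/2\<close> and
    \<open>q = (x - p)/a\<close> lie in \<open>F k\<close>, hence in
    \<open>E \<inter> F k = F m\<close>.\<close>
  have "F k \<subseteq> F (Suc m)"
  proof
    fix x assume x: "x \<in> F k"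
    have xn: "x \<in> F n" using x B(3) by blast
    obtain p q where pq: "p \<in> E" "q \<in> E" "x = p \<oplus> q \<otimes> a" by (rule quadratic_decompose[OF qa xn])
    have pqn: "p \<in> F n" "q \<in> F n" using pq Q(3) by auto
    have cc: "p \<in> carrier R" "q \<in> carrier R" "a \<in> carrier R" using pq dE(1) A(7) by auto
    have sx: "s x = p \<ominus> q \<otimes> a"
    proof -
      have "s x = p \<oplus> q \<otimes> (\<ominus> a)"
        unfolding pq(3) using pqn an g(3)[OF pq(1)] g(3)[OF pq(2)] s(2) by (simp add: g(4,5) dn(5))
      then show ?thesis using cc by algebra
    qed
    have sxk: "s x \<in> F k" using sk x by blast
    have "p = half \<otimes> (x \<oplus> s x)"
    proof -
      have "x \<oplus> s x = (p \<oplus> q \<otimes> a) \<oplus> (p \<ominus> q \<otimes> a)" using sx pq(3) by simp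
      also have "\<dots> = p \<oplus> p" using cc by algebra
      finally have "x \<oplus> s x = p \<oplus> p" .
      then show ?thesis using half_double_mult[OF cc(1)] cc by (simp add: r_distr)
    qed
    then have pk: "p \<in> F k" using dk(4,5) half_in_subfield[OF Fk] x sxk by simp
    have "q = (x \<ominus> p) \<otimes> inv a"
    proof -
      have "(x \<ominus> p) \<otimes> inv a = q \<otimes> (a \<otimes> inv a)"
        unfolding pq(3) using cc subfield_closed(8)[OF carrier_is_subfield cc(3) A(8)] by algebra
      then show ?thesis using cc A(8) by (simp add: field_Units)
    qed
    then have qk: "q \<in> F k" using dk(5,7,8) x pk ak A(8) by simp
    have "p \<in> F m" "q \<in> F m" using pk qk pq E(3) by auto
    then show "x \<in> F (Suc m)" unfolding pq(3) using A(3,4) subfield_closed(4,5)[OF A(2)] by blast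
  qed
  then have km: "k = Suc m" using two_tower_not_subset[OF T, of "Suc m" k] mk' kN by fastforce
  have "\<not> E \<subseteq> F k"
    using quadratic_no_intermediate[OF e Fk] E(2) B(3,4,5) by blast
  then obtain y where y: "y \<in> E" "y \<notin> F k" by blast
  have yn: "y \<in> F n" using y Q(3) by blast
  \<comment> \<open>The quadratic equation of \<open>y\<close> over \<open>F k\<close> is conjugated
    by \<open>s\<close>. Since \<open>s\<close> fixes \<open>y\<close> and preserves
    \<open>F k\<close>, uniqueness of coordinates shows that \<open>t\<close> and \<open>u\<close>
    are fixed, so they lie in \<open>E \<inter> F k = F m\<close>.\<close>
  obtain t u where tu: "t \<in> F k" "u \<in> F k" "y \<otimes> y = t \<oplus> u \<otimes> y"
    by (rule quadratic_change[OF b yn y(2) dn(5)[OF yn yn]])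
  have tun: "t \<in> F n" "u \<in> F n" using tu B(3) by auto
  have "s t \<oplus> s u \<otimes> y = t \<oplus> u \<otimes> y"
  proof -
    have "s (y \<otimes> y) = s t \<oplus> s u \<otimes> s y" unfolding tu(3) by (simp add: g(4,5) tun yn dn(5))
    then show ?thesis using g(3)[OF y(1)] g(5)[OF yn yn] tu(3) by simp
  qed
  moreover have "s t \<in> F k" "s u \<in> F k" using tu sk by auto
  ultimately have "s t = t" "s u = u"
    using coordinates_unique[OF Fk dE(1)[OF y(1)] y(2), of "s t" "s u" t u] tu by auto
  then have "t \<in> E" "u \<in> E" using s(4) tun by auto
  then have tum: "t \<in> F m" "u \<in> F m" using tu E(3) by auto
  define h where "h = half \<otimes> u"
  have hm: "h \<in> F m" unfolding h_def by (simp add: dm(5) half_in_subfield[OF A(1)] tum)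
  have hu: "h \<oplus> h = u" unfolding h_def by (simp add: half_double_mult dm(1) tum)
  \<comment> \<open>Completing the square uses only the coefficients \<open>t\<close> and
    \<open>u\<close> from \<open>F m\<close>, so the square of \<open>c\<close> drops to
    \<open>F m\<close> and not merely to \<open>F k\<close>.\<close>
  define c where "c = y \<ominus> h"
  have cc: "t \<in> carrier R" "h \<in> carrier R" "y \<in> carrier R" using tum hm dm(1) dE(1) y by auto
  have hE: "h \<in> E" and hk: "h \<in> F k" using hm E(3) by auto
  have cn: "c \<in> F n" unfolding c_def using yn hE Q(3) dn(7) by blast
  have "y = c \<oplus> h" unfolding c_def using cc by algebra
  then have ck: "c \<notin> F k" using dk(4)[OF _ hk, of c] y(2) by auto
  have "c \<otimes> c = y \<otimes> y \<ominus> (h \<oplus> h) \<otimes> y \<oplus> h \<otimes> h" unfolding c_def using cc by algebra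
  also have "\<dots> = (t \<oplus> (h \<oplus> h) \<otimes> y) \<ominus> (h \<oplus> h) \<otimes> y \<oplus> h \<otimes> h" using tu(3) hu by simp
  also have "\<dots> = t \<oplus> h \<otimes> h" using cc by algebra
  finally have ccm: "c \<otimes> c \<in> F m" using dm(4,5) tum hm by simp
  have "quadratic (F k) (F n) c"
    using quadraticI_adjoin[OF b cn ck] ccm E(3) by blast
  then show ?thesis using a ccm k km by blast
qed

text \<open>Each member of a finite spanning list lies in some tower field, and the tower is
  increasing, so one field contains the whole list and its span.\<close>

lemma finite_extension_subset_tower:
  assumes T: "two_tower N F" and E: "finite_field_extension (F 0) E" "E \<subseteq> (\<Union>n\<in>{n. enat n \<le> N}. F n)"
  shows "\<exists>n. enat n \<le> N \<and> E \<subseteq> F n"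
proof -
  have K: "subfield (F 0) R" and d: "finite_dimension (F 0) E" using E(1) unfolding finite_field_extension_def by auto
  have z: "enat 0 \<le> N" by (simp add: zero_enat_def[symmetric])
  obtain k where "dimension k (F 0) E" using d by blast
  then obtain Us where Us: "set Us \<subseteq> carrier R" "Span (F 0) Us = E" using exists_base[OF K] by blast
  then have "set Us \<subseteq> E" using Span_base_incl[OF K] by blast
  then have "set Us \<subseteq> (\<Union>n\<in>{n. enat n \<le> N}. F n)" using E(2) by blast
  then have "\<exists>n. enat n \<le> N \<and> set Us \<subseteq> F n"
  proof (induction Us)
    case Nil
    then show ?case using z by auto
  next
    case (Cons u Us)
    then obtain i j where ij: "enat i \<le> N" "set Us \<subseteq> F i" "enat j \<le> N" "u \<in> F j" by auto
    have m: "enat (max i j) \<le> N" using ij by (simp add: max_def)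
    show ?case
      using ij m two_tower_mono[OF T, of i "max i j"] two_tower_mono[OF T, of j "max i j"] by fastforce
  qed
  then obtain n where n: "enat n \<le> N" "set Us \<subseteq> F n" by blast
  note S = subfieldE(1)[OF two_tower_subfield[OF T n(1)]]
  have "F 0 \<subseteq> F n" using two_tower_mono[OF T _ n(1)] by simp
  then have "E \<subseteq> F n"
    using ring.Span_in_carrier[OF subring_is_ring[OF S], of "F 0" Us] n(2) Us(2)
    unfolding Span_consistent[OF S] by simp
  then show ?thesis using n by blast
qed

lemma not_thin_imp_biquadratic:
  assumes T: "two_tower N F" and "\<not> thin N F"
  shows "\<exists>m a c. enat (Suc (Suc m)) \<le> N \<and> quadratic (F m) (F (Suc m)) a \<and>
    quadratic (F (Suc m)) (F (Suc (Suc m))) c \<and> c \<otimes> c \<in> F m"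
proof -
  obtain E where E: "finite_field_extension (F 0) E" "E \<subseteq> (\<Union>n\<in>{n. enat n \<le> N}. F n)"
    "\<And>n. enat n \<le> N \<Longrightarrow> E \<noteq> F n" using assms(2) unfolding thin_def by blast
  \<comment> \<open>The bound \<open>j \<le> n\<close> makes failure of \<open>P m\<close> yield an
    index at most \<open>m\<close>, which is the form of minimality needed for the least
    \<open>n\<close>.\<close>
  define P where "P = (\<lambda>n. enat n \<le> N \<and> (\<exists>E. subfield E R \<and> F 0 \<subseteq> E \<and> E \<subseteq> F n \<and> (\<forall>j\<le>n. E \<noteq> F j)))"
  obtain n where "enat n \<le> N" "E \<subseteq> F n" using finite_extension_subset_tower[OF T E(1,2)] by blast
  then have "P n" unfolding P_def using E(1,3) enat_le_mono unfolding finite_field_extension_def by blast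
  then obtain n where n: "P n" "\<And>m. m < n \<Longrightarrow> \<not> P m" using exists_least_iff[of P] by blast
  then obtain E' where E': "enat n \<le> N" "subfield E' R" "F 0 \<subseteq> E'" "E' \<subseteq> F n" "\<forall>j\<le>n. E' \<noteq> F j"
    unfolding P_def by blast
  have "\<exists>j\<le>m. D = F j" if "m < n" "subfield D R" "F 0 \<subseteq> D" "D \<subseteq> F m" for m D
    using n(2)[OF that(1)] that(2-4) E'(1) enat_le_mono[of m n] that(1) unfolding P_def by auto
  from minimal_extra_subfield_biquadratic[OF T E'(1) this E'(2-4)] E'(5) obtain m a c where
    "n = Suc (Suc m) \<and> quadratic (F m) (F (Suc m)) a \<and> quadratic (F (Suc m)) (F n) c \<and> c \<otimes> c \<in> F m" by blast
  then show ?thesis using E'(1) by blast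
qed

end

section \<open>The Klein four-group\<close>

lemma klein_four_group_simps:
  "carrier klein_four_group = {0, 1} \<times> {0, 1}"
  "(i, j) \<otimes>\<^bsub>klein_four_group\<^esub> (k, l) = ((i + k) mod 2, (j + l) mod 2)"
proof -
  have "{0..<2::int} = {0, 1}" by auto
  then show "carrier klein_four_group = {0, 1} \<times> {0, 1}"
    by (simp add: klein_four_group_def carrier_integer_mod_group)
qed (simp add: klein_four_group_def)

context field_two_nonzero
begin

section \<open>From the Klein four-group to a field outside the tower\<close>

lemma galois_fixed_subfield:
  assumes "subfield K R" "subfield E R" "K \<subseteq> E" "s \<in> carrier (galois_group K E)"
  shows "subfield {x \<in> E. s x = x} R"
proof -
  note g = galois_group_elem[OF assms] note d = subfield_closed[OF assms(2)]
  show ?thesis by (rule subfieldI_closed) (auto simp: d g)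
qed

text \<open>Every element of \<open>E\<close> is a combination of 1 and \<open>b\<close> over
  \<open>M\<close>.\<close>

lemma galois_eq_on_subfield:
  assumes "subfield K R" and q: "quadratic M E b" and KE: "K \<subseteq> E"
    and s: "s \<in> carrier (galois_group K E)" and t: "t \<in> carrier (galois_group K E)"
    and eq: "\<And>x. x \<in> M \<Longrightarrow> s x = t x" "s b = t b" and x: "x \<in> E"
  shows "s x = t x"
proof -
  note Q = quadraticD[OF q] note d = subfield_closed[OF Q(2)]
  note g = galois_group_elem[OF assms(1) Q(2) KE s] note h = galois_group_elem[OF assms(1) Q(2) KE t]
  obtain u v where uv: "u \<in> M" "v \<in> M" "x = u \<oplus> v \<otimes> b" by (rule quadratic_decompose[OF q x])
  have "u \<in> E" "v \<in> E" using uv Q(3) by auto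
  then show ?thesis unfolding uv(3) using eq uv(1,2) Q(4) by (simp add: g(4,5) h(4,5) d(5))
qed

lemma galois_eqI:
  assumes "subfield K R" "K \<subseteq> E" "s \<in> carrier (galois_group K E)" "t \<in> carrier (galois_group K E)"
    "\<And>x. x \<in> E \<Longrightarrow> s x = t x"
  shows "s = t"
  using assms extensionalityI[of s E t] by (simp add: galois_group_carrier_iff)

lemma galois_square_root:
  assumes "subfield K R" "subfield E R" "K \<subseteq> E" "s \<in> carrier (galois_group K E)"
    and "b \<in> E" "s (b \<otimes> b) = b \<otimes> b"
  shows "s b = b \<or> s b = \<ominus> b"
proof -
  note g = galois_group_elem[OF assms(1-4)] note d = subfield_closed[OF assms(2)]
  have "s b \<otimes> s b = b \<otimes> b" using g(5)[OF assms(5,5)] assms(6) by simp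
  then show ?thesis using square_eq_imp g(1) d(1) assms(5) by blast
qed

text \<open>The extra field is the fixed field of an automorphism that moves the middle field. Two
  facts about the group suffice: every element squares to the identity, and there are four
  elements.\<close>

lemma klein_four_imp_not_thin:
  assumes T: "two_tower N F" and mN: "enat (Suc (Suc m)) \<le> N"
    and iso: "galois_group (F m) (F (Suc (Suc m))) \<cong> klein_four_group"
  shows "\<not> thin N F"
proof -
  define K M E where KME: "K = F m" "M = F (Suc m)" "E = F (Suc (Suc m))"
  have mN': "enat (Suc m) \<le> N" "enat m \<le> N" using mN enat_le_mono[of _ "Suc (Suc m)"] by auto
  obtain a where a: "quadratic K M a" using two_tower_quadratic[OF T mN'(1)] KME by blast
  obtain b where b: "quadratic M E b" using two_tower_quadratic[OF T mN] KME by blast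
  note A = quadraticD[OF a] note B = quadraticD[OF b]
  note dK = subfield_closed[OF A(1)] note dM = subfield_closed[OF A(2)] note dE = subfield_closed[OF B(2)]
  have KE: "K \<subseteq> E" using A B by blast
  define G where "G = galois_group K E"
  note mem = galois_group_elem[OF A(1) B(2) KE, folded G_def]
  obtain h where hom: "h \<in> hom G klein_four_group" and bij: "bij_betw h (carrier G) (carrier klein_four_group)"
    using iso unfolding is_iso_def iso_def KME G_def by blast
  have kl: "x \<otimes>\<^bsub>klein_four_group\<^esub> x = (0, 0)" if "x \<in> carrier klein_four_group" for x
    using that by (auto simp: klein_four_group_simps)
  have hc: "h g \<in> carrier klein_four_group" if "g \<in> carrier G" for g using that bij bij_betwE by blast
  have hsq: "h (g \<otimes>\<^bsub>G\<^esub> g) = (0, 0)" if "g \<in> carrier G" for g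
    using hom that kl[OF hc[OF that]] by (simp add: hom_def)
  \<comment> \<open>Both \<open>e\<close> and the square of \<open>g\<close> are sent by
    \<open>h\<close> to \<open>(0, 0)\<close>, the former because \<open>e\<close> is idempotent;
    injectivity identifies them.\<close>
  have inv: "g (g x) = x" if g: "g \<in> carrier G" and x: "x \<in> E" for g x
  proof -
    define e where "e = (\<lambda>x\<in>E. x)"
    have e: "e \<in> carrier G" unfolding e_def G_def by (rule galois_group_id[OF A(1) B(2) KE])
    have ee: "e \<otimes>\<^bsub>G\<^esub> e = e" using galois_group_mult[of e K E e] e unfolding G_def
      by (auto simp: e_def compose_def)
    have gg: "g \<otimes>\<^bsub>G\<^esub> g = compose E g g" using galois_group_mult g unfolding G_def by blast
    have "compose E g g \<in> carrier G"
      using galois_group_mult_closed[OF A(1) B(2) KE] g unfolding G_def by blast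
    moreover have "h (compose E g g) = h e" using hsq[OF g] hsq[OF e] gg ee by simp
    ultimately have "compose E g g = e" using bij e unfolding bij_betw_def inj_on_def by blast
    then have "compose E g g x = e x" by simp
    then show ?thesis using x by (simp add: compose_eq e_def)
  qed
  have aE: "a \<in> E" using A(4) B(3) by blast
  \<comment> \<open>If every automorphism fixed \<open>a\<close>, it would fix \<open>M\<close>
    pointwise and be determined by its value \<open>b\<close> or \<open>- b\<close> at
    \<open>b\<close>, leaving at most two automorphisms instead of four.\<close>
  have "\<exists>s\<in>carrier G. s a \<noteq> a"
  proof (rule ccontr)
    assume n: "\<not> ?thesis"
    have fixM: "s x = x" if s: "s \<in> carrier G" and x: "x \<in> M" for s x
    proof -
      obtain p q where pq: "p \<in> K" "q \<in> K" "x = p \<oplus> q \<otimes> a" by (rule quadratic_decompose[OF a x])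
      have "p \<in> E" "q \<in> E" using pq KE by auto
      moreover have "s a = a" using n s by blast
      ultimately show ?thesis unfolding pq(3) using pq(1,2) aE by (simp add: mem(3,4,5)[OF s] dE(5))
    qed
    have "s b \<in> {b, \<ominus> b}" if s: "s \<in> carrier G" for s
      using galois_square_root[OF A(1) B(2) KE _ B(4)] s fixM[OF s B(6)] unfolding G_def by blast
    then have "(\<lambda>s. s b) ` carrier G \<subseteq> {b, \<ominus> b}" by blast
    moreover have "inj_on (\<lambda>s. s b) (carrier G)"
    proof (rule inj_onI)
      fix s t assume st: "s \<in> carrier G" "t \<in> carrier G" "s b = t b"
      have eqM: "s x = t x" if "x \<in> M" for x using fixM[OF st(1) that] fixM[OF st(2) that] by simp
      have "s x = t x" if "x \<in> E" for x
        by (rule galois_eq_on_subfield[OF A(1) b KE st(1,2)[unfolded G_def] eqM st(3) that])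
      then show "s = t" using galois_eqI[OF A(1) KE] st unfolding G_def by blast
    qed
    ultimately have "card (carrier G) \<le> card {b, \<ominus> b}"
      by (intro card_inj_on_le) auto
    also have "\<dots> \<le> 2" by (simp add: card_insert_if)
    finally have "card (carrier G) \<le> 2" .
    moreover have "card (carrier G) = 4"
      using bij_betw_same_card[OF bij] by (simp add: klein_four_group_simps card_cartesian_product)
    ultimately show False by simp
  qed
  then obtain s where s: "s \<in> carrier G" "s a \<noteq> a" by blast
  note g = mem[OF s(1)]
  have sa: "s a = \<ominus> a"
    using galois_square_root[OF A(1) B(2) KE _ aE] s g(3)[OF A(6)] unfolding G_def by blast
  define D where "D = {x \<in> E. s x = x}"
  have D: "subfield D R" "K \<subseteq> D" "D \<subseteq> E" "a \<notin> D"
    using galois_fixed_subfield[OF A(1) B(2) KE] s KE g(3) unfolding D_def G_def by auto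
  \<comment> \<open>Suppose only \<open>K\<close> is fixed. Then \<open>b + s b\<close> lies in
    \<open>K\<close>; subtracting half of it from \<open>b\<close> gives \<open>d\<close> with
    \<open>s d = - d\<close>. Now \<open>d a\<close> is a product of two negated elements, hence
    fixed and in \<open>K\<close>, which puts \<open>d\<close> and therefore \<open>b\<close> in
    \<open>M\<close>.\<close>
  have "D \<noteq> K"
  proof
    assume DK: "D = K"
    define w where "w = b \<oplus> s b"
    have sb: "s b \<in> E" using g(1) B(4) by blast
    have "w \<in> E" "s w = w"
      unfolding w_def using sb B(4) inv[OF s(1) B(4)] dE(1) by (auto simp: dE(4) g(4) a_comm)
    then have wK: "w \<in> K" using DK unfolding D_def by blast
    define u where "u = half \<otimes> w"
    have uK: "u \<in> K" unfolding u_def using half_in_subfield[OF A(1)] wK dK(5) by blast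
    have uE: "u \<in> E" and uM: "u \<in> M" using uK KE A(3) by auto
    have uu: "u \<oplus> u = b \<oplus> s b" unfolding u_def w_def[symmetric] using half_double_mult wK dK(1) by blast
    have cc: "u \<in> carrier R" "b \<in> carrier R" "s b \<in> carrier R" "a \<in> carrier R"
      using uK dK(1) B(7) sb dE(1) A(7) by auto
    define d where "d = b \<ominus> u"
    have dd: "d \<in> E" unfolding d_def using B(4) uE dE(7) by blast
    have "s d = s b \<ominus> u" unfolding d_def using g(9)[OF B(4) uE] g(3)[OF uK] by simp
    also have "\<dots> = (b \<oplus> s b) \<ominus> u \<ominus> b" using cc by algebra
    also have "\<dots> = (u \<oplus> u) \<ominus> u \<ominus> b" using uu by simp
    also have "\<dots> = \<ominus> d" unfolding d_def using cc by algebra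
    finally have sd: "s d = \<ominus> d" .
    have "s (d \<otimes> a) = d \<otimes> a"
      using g(5)[OF dd aE] sd sa cc dE(1)[OF dd] by (simp add: l_minus r_minus)
    then have "d \<otimes> a \<in> K" using DK dE(5)[OF dd aE] unfolding D_def by blast
    then have "(d \<otimes> a) \<otimes> inv a \<in> M" using A(3,4,8) dM(5,8) by blast
    then have "d \<in> M" using dE(1)[OF dd] cc A(8) by (simp add: m_assoc field_Units)
    then have "d \<oplus> u \<in> M" using uM dM(4) by blast
    moreover have "d \<oplus> u = b" unfolding d_def using cc by algebra
    ultimately show False using B(5) by simp
  qed
  have F0: "F 0 \<subseteq> K" "subfield (F 0) R"
    using two_tower_mono[OF T _ mN'(2)] two_tower_subfield[OF T, of 0] enat_le_mono[OF _ mN'(2)] KME by auto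
  have "subalgebra (F 0) D R"
  proof (rule subalgebra.intro)
    show "subgroup D (add_monoid R)" using subfieldE(1)[OF D(1)] subring.axioms(1) by blast
    show "subalgebra_axioms (F 0) D R"
      using F0(1) D(2) subfield_closed(5)[OF D(1)] unfolding subalgebra_axioms_def by blast
  qed
  then have "finite_dimension (F 0) D"
    using subalbegra_incl_imp_finite_dimension[OF F0(2) two_tower_finite_dimension[OF T mN]] D(3) KME by blast
  then have "finite_field_extension (F 0) D"
    unfolding finite_field_extension_def using F0 D by blast
  moreover have "D \<subseteq> (\<Union>n\<in>{n. enat n \<le> N}. F n)" using D(3) mN KME by blast
  \<comment> \<open>Up to level \<open>m\<close> the tower fields lie in \<open>K\<close>, which is
    properly contained in \<open>D\<close>; from level \<open>m + 1\<close> on they contain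
    \<open>a\<close>, which \<open>D\<close> omits.\<close>
  moreover have "D \<noteq> F j" if j: "enat j \<le> N" for j
  proof (cases "j \<le> m")
    case True
    then show ?thesis using two_tower_mono[OF T True mN'(2)] D(2) \<open>D \<noteq> K\<close> KME by blast
  next
    case False
    then have "M \<subseteq> F j" using two_tower_mono[OF T _ j, of "Suc m"] KME by simp
    then show ?thesis using A(4) D(4) by blast
  qed
  ultimately show ?thesis unfolding thin_def by blast
qed

section \<open>Biquadratic extensions\<close>

lemma galois_eval:
  assumes "subfield K R" "subfield E R" "K \<subseteq> E" "s \<in> carrier (galois_group K E)"
    and "set p \<subseteq> K" and x: "x \<in> E"
  shows "eval p x \<in> E" "eval p (s x) = s (eval p x)"
proof -
  note g = galois_group_elem[OF assms(1-4)] note d = subfield_closed[OF assms(2)]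
  have pw: "x [^] n \<in> E \<and> s x [^] n = s (x [^] n)" for n :: nat
    by (induction n) (auto simp: d g x)
  have "eval p x \<in> E \<and> eval p (s x) = s (eval p x)" using assms(5)
  proof (induction p)
    case (Cons k p)
    have k: "k \<in> K" "k \<in> E" using Cons.prems assms(3) by auto
    then show ?case using Cons pw[of "length p"] by (simp add: d(4,5) g(3,4,5))
  qed (simp add: d g)
  then show "eval p x \<in> E" "eval p (s x) = s (eval p x)" by auto
qed

text \<open>An irreducible polynomial with a root in \<open>D\<close> has degree at most
  \<open>n\<close>, the dimension of \<open>D\<close>. If at least \<open>n\<close> distinct roots
  are known, these are all the roots and each is simple.\<close>

lemma pirreducible_splits_distinct:
  assumes K: "subfield K R" and D: "subfield D R" "K \<subseteq> D" "dimension n K D"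
    and p: "p \<in> carrier (K[X])" "pirreducible K p" and x: "x \<in> D" "eval p x = \<zero>"
    and S: "finite S" "n \<le> card S" "\<And>y. y \<in> S \<Longrightarrow> y \<in> carrier R \<and> eval p y = \<zero>"
  shows "splitted p" "set_mset (roots p) = S" "alg_mult p y \<le> 1"
proof -
  note d = subfield_closed[OF D(1)]
  have xc: "x \<in> carrier R" using x d(1) by blast
  have alg: "(algebraic over K) x"
    using finite_dimension_imp_algebraic[OF K subfieldE(1)[OF D(1)] finite_dimensionI[OF D(3)] x(1)] .
  note I = IrrE[OF K xc alg]
  have pR: "p \<in> carrier (poly_ring R)" using carrier_polynomial_shell[OF subfieldE(1)[OF K] p(1)] .
  have pne: "p \<noteq> []" using pirreducibleE(1)[OF subfieldE(1)[OF K] p(1,2)] .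
  \<comment> \<open>Both polynomials are irreducible and one divides the other, so they are
    associated and have equal degree.\<close>
  have "(Irr K x) pdivides p" using Irr_minimal[OF K xc alg p(1) x(2)] .
  then have "p \<in> PIdl\<^bsub>K[X]\<^esub> (Irr K x)"
    using Irr_generates_ker[OF K xc alg] p(1) x(2) unfolding a_kernel_def' by auto
  then have "(Irr K x) \<sim>\<^bsub>K[X]\<^esub> p" using cgenideal_pirreducible[OF K I(1,2) p(2)] by blast
  then have deg: "length p - 1 = length (Irr K x) - 1"
    using associated_polynomials_imp_same_length[OF subfieldE(1)[OF K] I(1) p(1)] by simp
  \<comment> \<open>The powers of \<open>x\<close> below the degree of its minimal polynomial are
    independent over \<open>K\<close> and lie in \<open>D\<close>, which bounds that degree by
    \<open>n\<close>.\<close>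
  have "x [^] i \<in> D" for i :: nat by (induction i) (auto simp: d x(1))
  then have "set (exp_base x (length (Irr K x) - 1)) \<subseteq> D" unfolding exp_base_def by auto
  then have "length (Irr K x) - 1 \<le> n"
    using independent_length_le_dimension[OF K D(3) exp_base_independent[OF K xc alg]]
    by (simp add: exp_base_def)
  then have le: "length p - 1 \<le> n" using deg by simp
  have sub: "mset_set S \<subseteq># roots p"
  proof (rule mset_subset_eqI)
    fix y show "count (mset_set S) y \<le> count (roots p) y"
      using S roots_mem_iff_is_root[OF pR, of y] pne
      by (cases "y \<in> S") (auto simp: is_root_def Suc_le_eq)
  qed
  have sz: "size (roots p) \<le> length p - 1" using size_roots_le_degree[OF pR] .
  have card: "card S \<le> size (roots p)" using size_mset_mono[OF sub] S(1) by simp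
  \<comment> \<open>The chain \<open>n \<le> card S \<le> size (roots p) \<le> length p - 1 \<le>
    n\<close> collapses to equalities.\<close>
  have eq: "roots p = mset_set S"
    using sub le sz card S(1,2) by (metis leD le_trans mset_subset_size size_mset_set
      subset_mset.le_imp_less_or_eq)
  show "splitted p" unfolding splitted_def using le sz card S(2) by simp
  show "set_mset (roots p) = S" using eq S(1) by simp
  show "alg_mult p y \<le> 1"
    unfolding alg_mult_eq_count_roots[OF pR] eq using S(1) by (simp add: count_mset_set')
qed

text \<open>An orbit consists of roots of any polynomial over \<open>K\<close> that vanishes at
  \<open>x\<close>. An orbit at least as large as the degree of a field \<open>D\<close> containing
  \<open>x\<close> thus gives splitting and simple roots together; \<open>D\<close> may depend on
  \<open>x\<close>.\<close>

lemma galois_extensionI: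
  assumes KE: "subfield K R" "subfield E R" "K \<subseteq> E"
    and orb: "\<And>x. x \<in> E \<Longrightarrow> \<exists>D n S. subfield D R \<and> K \<subseteq> D \<and> dimension n K D \<and> x \<in> D \<and>
       finite S \<and> n \<le> card S \<and> S \<subseteq> (\<lambda>s. s x) ` carrier (galois_group K E)"
  shows "galois_extension K E"
proof -
  have *: "splitted p \<and> set_mset (roots p) \<subseteq> E \<and> (\<forall>y. alg_mult p y \<le> 1)"
    if x: "x \<in> E" and p: "p \<in> carrier (K[X])" "pirreducible K p" "eval p x = \<zero>" for x p
  proof -
    obtain D n S where D: "subfield D R" "K \<subseteq> D" "dimension n K D" "x \<in> D" and S: "finite S" "n \<le> card S"
      and orbS: "S \<subseteq> (\<lambda>s. s x) ` carrier (galois_group K E)" using orb[OF x] by blast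
    have pK: "set p \<subseteq> K" using p(1) unfolding univ_poly_def polynomial_def by auto
    have S': "y \<in> E \<and> eval p y = \<zero>" if y: "y \<in> S" for y
    proof -
      obtain s where s: "s \<in> carrier (galois_group K E)" "y = s x" using orbS y by blast
      show ?thesis using galois_eval(2)[OF KE s(1) pK x] galois_group_elem(1,6)[OF KE s(1)] x p(3) s(2) by simp
    qed
    then have "\<And>y. y \<in> S \<Longrightarrow> y \<in> carrier R \<and> eval p y = \<zero>" using subfield_closed(1)[OF KE(2)] by blast
    note r = pirreducible_splits_distinct[OF KE(1) D(1-3) p(1,2) D(4) p(3) S this]
    show ?thesis using r S' by blast
  qed
  have alg: "(algebraic over K) x" if x: "x \<in> E" for x
  proof -
    obtain D n where "subfield D R" "dimension n K D" "x \<in> D" using orb[OF x] by blast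
    then show ?thesis
      using finite_dimension_imp_algebraic[OF KE(1) subfieldE(1) finite_dimensionI] by blast
  qed
  have "alg_mult (Irr K x) y \<le> 1" if x: "x \<in> E" for x y
    using *[OF x] IrrE[OF KE(1) subfield_closed(1)[OF KE(2) x] alg[OF x]] by blast
  then show ?thesis
    unfolding galois_extension_def normal_extension_def separable_extension_def
    using KE * alg by blast
qed

text \<open>With \<open>C = K(c)\<close>, the field \<open>E\<close> is also quadratic over
  \<open>C\<close> with generator \<open>a\<close>; the required map is the conjugation over
  \<open>C\<close>.\<close>

lemma biquadratic_conjugation:
  assumes a: "quadratic K M a" and c: "quadratic M E c" and cc: "c \<otimes> c \<in> K"
  obtains C t where "quadratic K C c" "C \<subseteq> E" "t \<in> carrier (galois_group K E)" "t a = \<ominus> a" "t c = c"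
    "\<And>x. x \<in> E \<Longrightarrow> t (t x) = x" "\<And>x. x \<in> E \<Longrightarrow> t x = x \<longleftrightarrow> x \<in> C"
proof -
  note A = quadraticD[OF a] note B = quadraticD[OF c]
  note dK = subfield_closed[OF A(1)] note dM = subfield_closed[OF A(2)] note dE = subfield_closed[OF B(2)]
  define C where "C = simple_extension K c"
  have cK: "c \<notin> K" using B(5) A(3) by blast
  have C: "quadratic K C c" unfolding C_def using simple_extension_quadratic[OF A(1) B(7) cK cc] .
  note Q = quadraticD[OF C] note dC = subfield_closed[OF Q(2)]
  have KE: "K \<subseteq> E" using A(3) B(3) by blast
  have CE: "C \<subseteq> E"
    unfolding C_def using simple_extension_subring_incl[OF subfieldE(1)[OF B(2)] KE B(4)] .
  have aE: "a \<in> E" using A(4) B(3) by blast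
  \<comment> \<open>Comparing \<open>a + 0 c\<close> with \<open>p + q c\<close> in coordinates over
    \<open>M\<close> would give \<open>a = p\<close> in \<open>K\<close>.\<close>
  have aC: "a \<notin> C"
  proof
    assume "a \<in> C"
    then obtain p q where pq: "p \<in> K" "q \<in> K" "a = p \<oplus> q \<otimes> c" by (rule quadratic_decompose[OF C])
    have "a \<oplus> \<zero> \<otimes> c = p \<oplus> q \<otimes> c" using pq(3) A(7) B(7) by simp
    then have "a = p" using coordinates_unique(1)[OF A(2) B(7,5), of a \<zero> p q] A(3,4) dM(2) pq by blast
    then show False using A(5) pq by blast
  qed
  have "\<exists>p\<in>C. \<exists>q\<in>C. x = p \<oplus> q \<otimes> a" if x: "x \<in> E" for x
  proof -
    obtain u v where uv: "u \<in> M" "v \<in> M" "x = u \<oplus> v \<otimes> c" by (rule quadratic_decompose[OF c x])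
    obtain p q where pq: "p \<in> K" "q \<in> K" "u = p \<oplus> q \<otimes> a" by (rule quadratic_decompose[OF a uv(1)])
    obtain r t where rt: "r \<in> K" "t \<in> K" "v = r \<oplus> t \<otimes> a" by (rule quadratic_decompose[OF a uv(2)])
    have k: "p \<in> carrier R" "q \<in> carrier R" "r \<in> carrier R" "t \<in> carrier R" using pq rt dK(1) by auto
    have "x = (p \<oplus> r \<otimes> c) \<oplus> (q \<oplus> t \<otimes> c) \<otimes> a"
      unfolding uv(3) pq(3) rt(3) using k A(7) B(7) by algebra
    moreover have "p \<oplus> r \<otimes> c \<in> C" "q \<oplus> t \<otimes> c \<in> C" using pq rt Q(3,4) dC(4,5) by blast+
    ultimately show ?thesis by blast
  qed
  then have "quadratic C E a" unfolding quadratic_def using Q(2,3) B(2) CE aE aC A(6) by blast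
  then obtain t where t: "t \<in> carrier (galois_group C E)" "t a = \<ominus> a"
    "\<And>x. x \<in> E \<Longrightarrow> t (t x) = x" "\<And>x. x \<in> E \<Longrightarrow> t x = x \<longleftrightarrow> x \<in> C"
    by (rule quadratic_conjugation) blast
  have "t \<in> carrier (galois_group K E)"
    using t(1) Q(3) unfolding galois_group_carrier_iff[OF Q(2) CE] galois_group_carrier_iff[OF A(1) KE] by blast
  moreover have "t c = c" using t(4) B(4) Q(4) by blast
  ultimately show ?thesis using that[OF C CE] t by blast
qed

text \<open>For \<open>x = p + q w\<close>, being fixed forces \<open>q = - q\<close>, hence
  \<open>q = 0\<close>.\<close>

lemma fixed_of_negated_generator:
  assumes K: "subfield E R" "K \<subseteq> E" and D: "quadratic K D w" "D \<subseteq> E"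
    and s: "s \<in> carrier (galois_group K E)" "s w = \<ominus> w" and x: "x \<in> D" "s x = x"
  shows "x \<in> K"
proof -
  note Q = quadraticD[OF D(1)] note d = subfield_closed[OF K(1)] note dK = subfield_closed[OF Q(1)]
  note g = galois_group_elem[OF Q(1) K s(1)]
  obtain p q where pq: "p \<in> K" "q \<in> K" "x = p \<oplus> q \<otimes> w" by (rule quadratic_decompose[OF D(1) x(1)])
  have pqE: "p \<in> E" "q \<in> E" "w \<in> E" using pq K Q(4) D(2) by auto
  have k: "p \<in> carrier R" "q \<in> carrier R" using pq dK(1) by auto
  have "s x = p \<oplus> q \<otimes> (\<ominus> w)" unfolding pq(3) using pqE pq(1,2) s(2) by (simp add: g(3,4,5) d(5))
  also have "\<dots> = p \<oplus> (\<ominus> q) \<otimes> w" using k Q(7) by algebra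
  finally have "p \<oplus> q \<otimes> w = p \<oplus> (\<ominus> q) \<otimes> w" using x(2) pq(3) by simp
  then have "q = \<ominus> q" using coordinates_unique(2)[OF Q(1,7,5)] pq dK(6) by blast
  then have "q = \<zero>" using eq_neg_imp_zero k by blast
  then show ?thesis using pq k Q(7) by simp
qed

lemma biquadratic_automorphism_eqI:
  assumes a: "quadratic K M a" and c: "quadratic M E c"
    and s: "s \<in> carrier (galois_group K E)" and t: "t \<in> carrier (galois_group K E)"
    and eq: "s a = t a" "s c = t c"
  shows "s = t"
proof -
  note A = quadraticD[OF a] note B = quadraticD[OF c]
  have KE: "K \<subseteq> E" using A(3) B(3) by blast
  note g = galois_group_elem[OF A(1) B(2) KE s] note h = galois_group_elem[OF A(1) B(2) KE t]
  have aE: "a \<in> E" using A(4) B(3) by blast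
  have M: "s x = t x" if x: "x \<in> M" for x
  proof -
    obtain p q where pq: "p \<in> K" "q \<in> K" "x = p \<oplus> q \<otimes> a" by (rule quadratic_decompose[OF a x])
    have "p \<in> E" "q \<in> E" using pq KE by auto
    then show ?thesis
      unfolding pq(3) using pq(1,2) eq aE by (simp add: g(3,4,5) h(3,4,5) subfield_closed(5)[OF B(2)])
  qed
  have "s x = t x" if "x \<in> E" for x by (rule galois_eq_on_subfield[OF A(1) c KE s t M eq(2) that])
  then show ?thesis using galois_eqI[OF A(1) KE s t] by blast
qed

text \<open>The four automorphisms are given by independent sign choices on \<open>a\<close> and
  \<open>c\<close>. Elements of \<open>K(a)\<close>, \<open>K(c)\<close> or \<open>K(a c)\<close>
  have an orbit at least as large as the degree of a suitable subfield containing them; all other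
  elements have four conjugates.\<close>

lemma biquadratic_galois:
  assumes a: "quadratic K M a" and c: "quadratic M E c" and cc: "c \<otimes> c \<in> K"
  shows "galois_extension K E" "galois_group K E \<cong> klein_four_group"
proof -
  note A = quadraticD[OF a] note B = quadraticD[OF c]
  note dK = subfield_closed[OF A(1)] note dM = subfield_closed[OF A(2)] note dE = subfield_closed[OF B(2)]
  have KE: "K \<subseteq> E" using A(3) B(3) by blast
  have aE: "a \<in> E" using A(4) B(3) by blast
  define G where "G = galois_group K E"
  note mem = galois_group_elem[OF A(1) B(2) KE, folded G_def]
  note eqI = biquadratic_automorphism_eqI[OF a c, folded G_def]
  note comp = galois_group_mult_closed[OF A(1) B(2) KE, folded G_def]
  define e where "e = (\<lambda>x\<in>E. x)"
  have e: "e \<in> carrier G" "e a = a" "e c = c"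
    unfolding e_def G_def using galois_group_id[OF A(1) B(2) KE] aE B(4) by auto
  obtain s where s0: "s \<in> carrier (galois_group M E)" "s c = \<ominus> c"
    "\<And>x. x \<in> E \<Longrightarrow> s (s x) = x" "\<And>x. x \<in> E \<Longrightarrow> s x = x \<longleftrightarrow> x \<in> M"
    by (rule quadratic_conjugation[OF c]) blast
  have s: "s \<in> carrier G" "s a = a"
    using s0(1,4) A(3,4) aE
    unfolding G_def galois_group_carrier_iff[OF A(2) B(3)] galois_group_carrier_iff[OF A(1) KE] by auto
  obtain C t where C: "quadratic K C c" "C \<subseteq> E" and t: "t \<in> carrier G" "t a = \<ominus> a" "t c = c"
    "\<And>x. x \<in> E \<Longrightarrow> t (t x) = x" "\<And>x. x \<in> E \<Longrightarrow> t x = x \<longleftrightarrow> x \<in> C"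
    unfolding G_def by (rule biquadratic_conjugation[OF a c cc]) blast
  define w where "w = a \<otimes> c"
  have wE: "w \<in> E" unfolding w_def using aE B(4) dE(5) by blast
  have wM: "w \<notin> M"
  proof
    assume "w \<in> M"
    then have "inv a \<otimes> w \<in> M" using A(4,8) dM(5,8) by blast
    moreover have "inv a \<otimes> w = c" unfolding w_def using A(7,8) B(7) by (simp add: m_assoc[symmetric] field_Units)
    ultimately show False using B(5) by simp
  qed
  have "w \<otimes> w = (a \<otimes> a) \<otimes> (c \<otimes> c)" unfolding w_def using A(7) B(7) by algebra
  then have ww: "w \<otimes> w \<in> K" using A(6) cc dK(5) by simp
  \<comment> \<open>The product \<open>w = a c\<close> may replace \<open>c\<close>, so the
    conjugation over \<open>K(w)\<close> supplies the automorphism \<open>r\<close> that negates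
    \<open>a\<close> and fixes \<open>w\<close>; it must then negate \<open>c\<close>.\<close>
  have qw: "quadratic M E w" using quadraticI_adjoin[OF c wE wM] ww A(3) by blast
  obtain W r where W: "quadratic K W w" "W \<subseteq> E" and r: "r \<in> carrier G" "r a = \<ominus> a" "r w = w"
    "\<And>x. x \<in> E \<Longrightarrow> r (r x) = x" "\<And>x. x \<in> E \<Longrightarrow> r x = x \<longleftrightarrow> x \<in> W"
    unfolding G_def by (rule biquadratic_conjugation[OF a qw ww]) blast
  have rc: "r c = \<ominus> c"
  proof -
    have "c = inv a \<otimes> w" unfolding w_def using A(7,8) B(7) by (simp add: m_assoc[symmetric] field_Units)
    then have "r c = r (inv a) \<otimes> w" using mem(5)[OF r(1) dE(8)[OF aE A(8)] wE] r(3) by simp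
    also have "r (inv a) = inv (\<ominus> a)" using mem(10)[OF r(1) aE A(8)] r(2) by simp
    also have "inv (\<ominus> a) \<otimes> w = \<ominus> c"
    proof -
      have na: "\<ominus> a \<noteq> \<zero>" "\<ominus> a \<in> carrier R" using A(7,8) by auto
      have "w = (\<ominus> a) \<otimes> (\<ominus> c)" unfolding w_def using A(7) B(7) by algebra
      then show ?thesis using na B(7) by (simp add: m_assoc[symmetric] field_Units)
    qed
    finally show ?thesis .
  qed
  have sw: "s w = \<ominus> w" unfolding w_def using mem(5)[OF s(1) aE B(4)] s(2) s0(2) A(7) B(7) by (simp add: r_minus)
  have na: "\<ominus> a \<noteq> a" and nc: "\<ominus> c \<noteq> c"
    using eq_neg_imp_zero[OF A(7)] eq_neg_imp_zero[OF B(7)] A(8) B(8) by auto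
  have mm: "g (\<ominus> a) = \<ominus> g a" "g (\<ominus> c) = \<ominus> g c" if "g \<in> carrier G" for g
    using mem(8)[OF that] aE B(4) by auto
  \<comment> \<open>These are the products in the Klein four-group, checked on \<open>a\<close> and
    \<open>c\<close> alone.\<close>
  have "compose E s t = r" "compose E s r = t" "compose E t r = s"
    by (rule eqI; simp add: compose_eq comp s t(1-3) r(1,2) rc s0(2) mm[OF s(1)] mm[OF t(1)] aE B(4) A(7) B(7))+
  then have st: "s (t x) = r x" "s (r x) = t x" "t (r x) = s x" if "x \<in> E" for x
    using that by (metis compose_eq)+
  show "galois_extension K E"
  proof (rule galois_extensionI[OF A(1) B(2) KE, folded G_def])
    fix x assume x: "x \<in> E"
    have xin: "x \<in> (\<lambda>s. s x) ` carrier G"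
      using image_eqI[of x "\<lambda>s. s x" e] e(1) x by (simp add: e_def)
    \<comment> \<open>For \<open>x\<close> in \<open>K\<close> the degree is 1 and
      \<open>{x}\<close> suffices; otherwise \<open>x\<close> and \<open>g x\<close> are two
      distinct conjugates in degree 2.\<close>
    have quad: "\<exists>D n S. subfield D R \<and> K \<subseteq> D \<and> dimension n K D \<and> x \<in> D \<and> finite S \<and> n \<le> card S \<and>
        S \<subseteq> (\<lambda>s. s x) ` carrier G"
      if D: "quadratic K D v" "D \<subseteq> E" "x \<in> D" and g: "g \<in> carrier G" "g v = \<ominus> v" for D v g
    proof (cases "x \<in> K")
      case True
      then show ?thesis using A(1) dimension_one[OF A(1)] xin
        by (intro exI[of _ K] exI[of _ 1] exI[of _ "{x}"]) auto
    next
      case False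
      have "g x \<noteq> x" using fixed_of_negated_generator[OF B(2) KE D(1,2) g(1)[unfolded G_def] g(2) D(3)] False
        by blast
      then show ?thesis using quadraticD(2,3)[OF D(1)] quadratic_dimension[OF D(1)] D(3) xin g(1)
        by (intro exI[of _ D] exI[of _ 2] exI[of _ "{x, g x}"]) auto
    qed
    show "\<exists>D n S. subfield D R \<and> K \<subseteq> D \<and> dimension n K D \<and> x \<in> D \<and> finite S \<and> n \<le> card S \<and>
        S \<subseteq> (\<lambda>s. s x) ` carrier G"
    proof (cases "x \<in> M \<or> x \<in> C \<or> x \<in> W")
      case True
      then show ?thesis
        using quad[of M a t] quad[of C c s] quad[of W w s] a B(3) t(1,2) C s(1) s0(2) W sw by blast
    next
      case False
      then have n: "s x \<noteq> x" "t x \<noteq> x" "r x \<noteq> x" using s0(4) t(5) r(5) x by auto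
      \<comment> \<open>Applying \<open>s\<close> to \<open>s x = t x\<close> would give
        \<open>x = r x\<close>; the other coincidences are excluded in the same way.\<close>
      have "s x \<noteq> t x" "s x \<noteq> r x" "t x \<noteq> r x"
        using n st[OF x] s0(3)[OF x] t(4)[OF x] by metis+
      then have "card {x, s x, t x, r x} = 4" using n by auto
      moreover have "dimension (2 * 2) K E"
        by (rule telescopic_base[OF A(1,2) quadratic_dimension[OF a] quadratic_dimension[OF c]])
      ultimately show ?thesis using B(2) KE x xin s(1) t(1) r(1)
        by (intro exI[of _ E] exI[of _ 4] exI[of _ "{x, s x, t x, r x}"]) auto
    qed
  qed
  have ga: "g a = a \<or> g a = \<ominus> a" and gc: "g c = c \<or> g c = \<ominus> c" if g: "g \<in> carrier G" for g
    using galois_square_root[OF A(1) B(2) KE _ aE] galois_square_root[OF A(1) B(2) KE _ B(4)]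
      mem(3)[OF g A(6)] mem(3)[OF g cc] g unfolding G_def by blast+
  \<comment> \<open>The two entries record the signs acquired by \<open>a\<close> and
    \<open>c\<close>, with 1 for a change of sign.\<close>
  define h :: "('a \<Rightarrow> 'a) \<Rightarrow> int \<times> int"
    where "h = (\<lambda>g. (if g a = a then 0 else 1, if g c = c then 0 else 1))"
  have hom: "h \<in> hom G klein_four_group"
  proof (rule homI)
    fix g assume "g \<in> carrier G"
    show "h g \<in> carrier klein_four_group" by (simp add: h_def klein_four_group_simps)
  next
    fix f g assume fg: "f \<in> carrier G" "g \<in> carrier G"
    have "f \<otimes>\<^bsub>G\<^esub> g = compose E f g" using galois_group_mult fg unfolding G_def by blast
    then show "h (f \<otimes>\<^bsub>G\<^esub> g) = h f \<otimes>\<^bsub>klein_four_group\<^esub> h g"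
      using ga[OF fg(1)] ga[OF fg(2)] gc[OF fg(1)] gc[OF fg(2)] mm[OF fg(1)] na nc aE B(4) A(7) B(7)
      by (auto simp: h_def klein_four_group_simps compose_eq)
  qed
  have "inj_on h (carrier G)"
  proof (rule inj_onI)
    fix f g assume fg: "f \<in> carrier G" "g \<in> carrier G" "h f = h g"
    have "f a = g a" "f c = g c"
      using fg(3) ga[OF fg(1)] ga[OF fg(2)] gc[OF fg(1)] gc[OF fg(2)] by (auto simp: h_def split: if_splits)
    then show "f = g" using eqI fg by blast
  qed
  moreover have "h ` carrier G = carrier klein_four_group"
  proof
    show "h ` carrier G \<subseteq> carrier klein_four_group" using hom by (auto simp: hom_def)
    have "h e = (0, 0)" "h s = (0, 1)" "h t = (1, 0)" "h r = (1, 1)"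
      using e s s0(2) t r rc na nc by (auto simp: h_def)
    then have "(0, 0) \<in> h ` carrier G" "(0, 1) \<in> h ` carrier G" "(1, 0) \<in> h ` carrier G" "(1, 1) \<in> h ` carrier G"
      using e(1) s(1) t(1) r(1) by (metis imageI)+
    then show "carrier klein_four_group \<subseteq> h ` carrier G" by (auto simp: klein_four_group_simps)
  qed
  ultimately show "galois_group K E \<cong> klein_four_group"
    using hom unfolding is_iso_def iso_def bij_betw_def G_def by blast
qed

end

section \<open>Characteristic zero and the equivalence\<close>

lemma subfield_iso_rat_two_nonzero:
  assumes "field L" "subfield Q L" "L\<lparr>carrier := Q\<rparr> \<simeq> (ring_of_type_algebra :: rat ring)"
  shows "field_two_nonzero L"
proof -
  interpret field L by fact
  have Q: "\<one>\<^bsub>L\<^esub> \<in> Q" "\<zero>\<^bsub>L\<^esub> \<in> Q" using subringE[OF subfieldE(1)[OF assms(2)]] by auto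
  obtain f where f: "f \<in> ring_hom (L\<lparr>carrier := Q\<rparr>) (ring_of_type_algebra :: rat ring)"
    using assms(3) unfolding is_ring_iso_def ring_iso_def by blast
  have add: "f (x \<oplus>\<^bsub>L\<^esub> y) = f x + f y" if "x \<in> Q" "y \<in> Q" for x y
    using ring_hom_add[OF f, of x y] that by (simp add: ring_of_type_algebra_def)
  have one: "f \<one>\<^bsub>L\<^esub> = 1" using ring_hom_one[OF f] by (simp add: ring_of_type_algebra_def)
  have zero: "f \<zero>\<^bsub>L\<^esub> = 0" using add[OF Q(2,2)] by simp
  \<comment> \<open>The prime field is compared with the rationals, where 2 is nonzero.\<close>
  have "f (\<one>\<^bsub>L\<^esub> \<oplus>\<^bsub>L\<^esub> \<one>\<^bsub>L\<^esub>) = 2" using add[OF Q(1,1)] one by simp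
  then have "\<one>\<^bsub>L\<^esub> \<oplus>\<^bsub>L\<^esub> \<one>\<^bsub>L\<^esub> \<noteq> \<zero>\<^bsub>L\<^esub>" using zero by auto
  then show ?thesis by unfold_locales
qed

theorem theorem2p4:
  fixes L :: "('a, 'b) ring_scheme" and Q :: "'a set"
    and N :: enat and F :: "nat \<Rightarrow> 'a set"
  assumes "algebraic_closure L Q"
    and "L\<lparr>carrier := Q\<rparr> \<simeq> (ring_of_type_algebra :: rat ring)"
    and "ring.two_tower L N F"
    and "ring.finite_field_extension L Q (F 0)"
  shows "\<not> ring.thin L N F \<longleftrightarrow>
    (\<exists>n\<ge>2. enat n \<le> N \<and> ring.galois_extension L (F (n - 2)) (F n) \<and>
            ring.galois_group L (F (n - 2)) (F n) \<cong> klein_four_group)"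
proof -
  interpret field_two_nonzero L
    using subfield_iso_rat_two_nonzero[OF algebraic_closure.axioms(1,2)[OF assms(1)] assms(2)] .
  show ?thesis
  proof
    assume "\<not> thin N F"
    then obtain m a c where "enat (Suc (Suc m)) \<le> N" "quadratic (F m) (F (Suc m)) a"
      "quadratic (F (Suc m)) (F (Suc (Suc m))) c" "c \<otimes>\<^bsub>L\<^esub> c \<in> F m"
      using not_thin_imp_biquadratic[OF assms(3)] by blast
    then show "\<exists>n\<ge>2. enat n \<le> N \<and> galois_extension (F (n - 2)) (F n) \<and>
        galois_group (F (n - 2)) (F n) \<cong> klein_four_group"
      using biquadratic_galois by (intro exI[of _ "Suc (Suc m)"]) auto
  next
    assume "\<exists>n\<ge>2. enat n \<le> N \<and> galois_extension (F (n - 2)) (F n) \<and>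
        galois_group (F (n - 2)) (F n) \<cong> klein_four_group"
    then obtain n where n: "n \<ge> 2" "enat n \<le> N" "galois_group (F (n - 2)) (F n) \<cong> klein_four_group"
      by blast
    \<comment> \<open>Natural subtraction truncates; \<open>n \<ge> 2\<close> makes it exact
      here.\<close>
    have "Suc (Suc (n - 2)) = n" using n(1) by simp
    then show "\<not> thin N F" using klein_four_imp_not_thin[OF assms(3), of "n - 2"] n by simp
  qed
qed

end
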